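(* Let $X\in\{\mathbf{S}^2\times\mathbf{R},\ \mathbf{H}^2\times\mathbf{R}\}$ and let $A_0A_1A_2$ be a geodesic triangle of fibre type in $X$ with surface $\mathcal{S}^X_{A_0A_1A_2}$. If $l$ is a line (geodesic curve) lying in the surface $\mathcal{S}^X_{A_0A_1A_2}$, not through any vertex of the triangle, such that $l$ meets the geodesic curves $g^X_{A_1A_2}$ in $Q$, $g^X_{A_0A_2}$ in $R$, and $g^X_{A_0A_1}$ in $P$, then $$s_f^X(A_0,P,A_1)\,s_f^X(A_1,Q,A_2)\,s_f^X(A_2,R,A_0)=-1.$$
   Context: Models. Points are written in homogeneous coordinates $(1,x,y,z)$ and identified with $(x,y,z)\in\mathbf{R}^3$; $E_0=(1,0,0,0)$ is the centre of the model (the Euclidean origin, not a point of $X$). $\mathbf{S}^2\times\mathbf{R}$ is $\{(x,y,z)\ne(0,0,0)\}$ with the Riemannian metric $ds^2=\frac{dx^2+dy^2+dz^2}{x^2+y^2+z^2}$; in coordinates $x=e^t\cos\phi\cos\theta$, $y=e^t\sin\phi\cos\theta$, $z=e^t\sin\theta$ this is $ds^2=dt^2+\cos^2\theta\,d\phi^2+d\theta^2$. $\mathbf{H}^2\times\mathbf{R}$ is $\{(x,y,z): x>0,\ x^2-y^2-z^2>0\}$ with the Riemannian metric which in coordinates $x=e^t\cosh r$, $y=e^t\sinh r\cos\alpha$, $z=e^t\sinh r\sin\alpha$ is $ds^2=dt^2+dr^2+\sinh^2 r\,d\alpha^2$. $d^X(P,Q)$ is the geodesic distance (arc length of the geodesic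 curve from $P$ to $Q$). $g^X_{PQ}$ denotes the geodesic curve containing $P$ and $Q$. Convention: for $X=\mathbf{S}^2\times\mathbf{R}$ all geodesic arcs considered are assumed to be less than or equal to a semicircle. Apollonius surface: $\mathcal{A}\mathcal{S}^X_{P_1P_2}(\lambda)$, $\lambda\in[0,\infty)$, is the set of all $P'\in X$ with $d^X(P_1,P')=\lambda\, d^X(P',P_2)$. Geodesic triangle: three points $A_0,A_1,A_2$ (vertices) with the geodesic segments joining them (sides). Surface of a geodesic triangle: for $\lambda_1,\lambda_2\in[0,\infty)$ with $\lambda_1^2+\lambda_2^2>0$ let $\mathcal{C}(\lambda_1,\lambda_2)=\mathcal{A}\mathcal{S}^X_{A_0A_1}(\lambda_1)\cap\mathcal{A}\mathcal{S}^X_{A_2A_0}(\lambda_2)$ if $\lambda_1,\lambda_2>0$, with $\mathcal{C}(\lambda_1,\lambda_2)=\{A_0\}$ if $\lambda_1=0$ and $\{A_2\}$ if $\lambda_2=0$. Let $P^X(\lambda_1,\lambda_2)=\{P\in\mathcal{C}(\lambda_1,\lambda_2): d^X(P,A_0)=\min_{Q\in\mathcal{C}(\lambda_1,\lambda_2)}d^X(Q,A_0)\}$. The surface $\mathcal{S}^X_{A_0A_1A_2}$ is the union of the $P^X(\lambda_1,\lambda_2)$ over all such $\lambda_1,\lambda_2$. The triangle is of fibre type if its surface lies in a Euclidean plane through $E_0$. For such a triangle the connecting curves (the "lines") of the surface are geodesic curves of $X$. Simply ratio (fibre type): for distinct points $A,B,P$ on a geodesic curve of $X$ lying in the plane of a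 fibre type triangle, $s_f^X(A,P,B)=d^X(A,P)/d^X(P,B)$ if $P$ is between $A$ and $B$, and $s_f^X(A,P,B)=-d^X(A,P)/d^X(P,B)$ otherwise.
   Formalization: For S²×R it is also assumed that the arcs joining the vertices and P, Q, R together miss some fibre of the plane (do not wrap around the centre), without which the identity can fail; l need only lie in the plane of the surface. *)

theory Defs
  imports "HOL-Analysis.Analysis"
begin

text \<open>
  A point $(1,x,y,z)$ of the projective model is written as the vector $(x,y,z)$; the centre
  $E_0$ of the model is the zero vector.
\<close>

datatype geometry = S2xR | H2xR

definition lorentz :: "real^3 \<Rightarrow> real^3 \<Rightarrow> real" where
  "lorentz v w = v$1 * w$1 - v$2 * w$2 - v$3 * w$3"

fun points :: "geometry \<Rightarrow> (real^3) set" where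
  "points S2xR = {p. p \<noteq> 0}"
| "points H2xR = {p. p$1 > 0 \<and> lorentz p p > 0}"

text \<open>
  The Riemannian metric, as the quadratic form $ds^2$ at the point \<open>p\<close> evaluated at the tangent
  vector \<open>v\<close>.  For H2xR this is the coordinate-free form of $dt^2+dr^2+\sinh^2 r\,d\alpha^2$,
  which also covers the axis $r=0$, where the polar coordinates are singular.  The lemmas
  \<open>metric_S2xR_coordinates\<close> and \<open>metric_H2xR_coordinates\<close> give the coordinate expressions.
\<close>

fun metric :: "geometry \<Rightarrow> real^3 \<Rightarrow> real^3 \<Rightarrow> real" where
  "metric S2xR p v = (v \<bullet> v) / (p \<bullet> p)"
| "metric H2xR p v = 2 * (lorentz p v / lorentz p p)\<^sup>2 - lorentz v v / lorentz p p"

definition curve_length :: "geometry \<Rightarrow> (real \<Rightarrow> real^3) \<Rightarrow> real \<Rightarrow> real \<Rightarrow> real" where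
  "curve_length X c a b =
     integral {a..b} (\<lambda>s. sqrt (metric X (c s) (vector_derivative c (at s))))"

definition gdist :: "geometry \<Rightarrow> real^3 \<Rightarrow> real^3 \<Rightarrow> real" where
  "gdist X P Q = Inf {curve_length X c 0 1 | c.
     c C1_differentiable_on {0..1} \<and> c ` {0..1} \<subseteq> points X \<and> c 0 = P \<and> c 1 = Q}"

text \<open>
  Geodesic curves are the complete curves of locally minimal arc length, here parametrised
  by arc length.
\<close>

definition geodesic :: "geometry \<Rightarrow> (real \<Rightarrow> real^3) \<Rightarrow> bool" where
  "geodesic X c \<longleftrightarrow> range c \<subseteq> points X \<and>
     (\<forall>s. \<exists>e>0. \<forall>a\<in>{s-e..s+e}. \<forall>b\<in>{s-e..s+e}. gdist X (c a) (c b) = \<bar>a - b\<bar>)"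

text \<open>
  \<open>geodesic_through X A B c\<close>: \<open>c\<close> parametrises the geodesic curve $g_{AB}$, starting at \<open>A\<close>.
  The distance of \<open>A\<close> and \<open>B\<close> is the length of the arc from \<open>A\<close> to \<open>B\<close>; in S2xR this selects, among
  the infinitely many geodesics joining two points, the one whose arc from \<open>A\<close> to \<open>B\<close> is at
  most a semicircle (two points over antipodal points of the sphere are joined by several).
\<close>

definition geodesic_through ::
    "geometry \<Rightarrow> real^3 \<Rightarrow> real^3 \<Rightarrow> (real \<Rightarrow> real^3) \<Rightarrow> bool" where
  "geodesic_through X A B c \<longleftrightarrow> geodesic X c \<and> c 0 = A \<and> c (gdist X A B) = B"

definition apollonius_surface :: "geometry \<Rightarrow> real^3 \<Rightarrow> real^3 \<Rightarrow> real \<Rightarrow> (real^3) set" where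
  "apollonius_surface X P1 P2 lam = {P \<in> points X. gdist X P1 P = lam * gdist X P P2}"

definition geodesic_triangle :: "geometry \<Rightarrow> real^3 \<Rightarrow> real^3 \<Rightarrow> real^3 \<Rightarrow> bool" where
  "geodesic_triangle X A0 A1 A2 \<longleftrightarrow>
     {A0, A1, A2} \<subseteq> points X \<and> A0 \<noteq> A1 \<and> A1 \<noteq> A2 \<and> A2 \<noteq> A0"

definition apollonius_curve ::
    "geometry \<Rightarrow> real^3 \<Rightarrow> real^3 \<Rightarrow> real^3 \<Rightarrow> real \<Rightarrow> real \<Rightarrow> (real^3) set" where
  "apollonius_curve X A0 A1 A2 l1 l2 =
     (if l1 = 0 then {A0} else if l2 = 0 then {A2}
      else apollonius_surface X A0 A1 l1 \<inter> apollonius_surface X A2 A0 l2)"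

definition surface_points ::
    "geometry \<Rightarrow> real^3 \<Rightarrow> real^3 \<Rightarrow> real^3 \<Rightarrow> real \<Rightarrow> real \<Rightarrow> (real^3) set" where
  "surface_points X A0 A1 A2 l1 l2 =
     {P \<in> apollonius_curve X A0 A1 A2 l1 l2.
        \<forall>Q \<in> apollonius_curve X A0 A1 A2 l1 l2. gdist X P A0 \<le> gdist X Q A0}"

definition triangle_surface :: "geometry \<Rightarrow> real^3 \<Rightarrow> real^3 \<Rightarrow> real^3 \<Rightarrow> (real^3) set" where
  "triangle_surface X A0 A1 A2 =
     \<Union> {surface_points X A0 A1 A2 l1 l2 | l1 l2. l1 \<ge> 0 \<and> l2 \<ge> 0 \<and> l1\<^sup>2 + l2\<^sup>2 > 0}"

definition plane_through_centre :: "(real^3) set \<Rightarrow> bool" where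
  "plane_through_centre W \<longleftrightarrow> (\<exists>n. n \<noteq> 0 \<and> W = {x. n \<bullet> x = 0})"

text \<open>
  A triangle is of fibre type iff there is a \<open>W\<close> with \<open>fibre_type_in X A0 A1 A2 W\<close>; then \<open>W\<close> is
  the plane of the triangle.  Since the minimality condition in \<open>surface_points\<close> selects, from
  two coplanar points with the same distance ratios, the one nearer to \<open>A0\<close>, the surface is only
  a bounded part of \<open>W\<close> (for non-collinear vertices in H2xR it lies in the closed circumscribed
  disc of the triangle).  No complete geodesic fits into it, and the side lines meet it only in the
  sides, so a transversal of the side lines has to range over \<open>W\<close> and not just over
  \<open>triangle_surface\<close>.
\<close>

definition fibre_type_in :: "geometry \<Rightarrow> real^3 \<Rightarrow> real^3 \<Rightarrow> real^3 \<Rightarrow> (real^3) set \<Rightarrow> bool" where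
  "fibre_type_in X A0 A1 A2 W \<longleftrightarrow>
     plane_through_centre W \<and> triangle_surface X A0 A1 A2 \<subseteq> W"

definition geodesic_between :: "geometry \<Rightarrow> real^3 \<Rightarrow> real^3 \<Rightarrow> real^3 \<Rightarrow> bool" where
  "geodesic_between X A P B \<longleftrightarrow>
     (\<exists>c. geodesic_through X A B c \<and> P \<in> c ` {0<..<gdist X A B})"

definition simply_ratio :: "geometry \<Rightarrow> real^3 \<Rightarrow> real^3 \<Rightarrow> real^3 \<Rightarrow> real" where
  "simply_ratio X A P B =
     (if geodesic_between X A P B then gdist X A P / gdist X P B
      else - (gdist X A P / gdist X P B))"

text \<open>The smallest arc of the curve \<open>c\<close> that contains the points with parameters in \<open>T\<close>.\<close>

definition arc_of :: "(real \<Rightarrow> real^3) \<Rightarrow> real set \<Rightarrow> (real^3) set" where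
  "arc_of c T = c ` (convex hull T)"

text \<open>The central projection of \<open>A\<close> to the unit sphere lies on a half great circle.\<close>

definition within_semicircle :: "(real^3) set \<Rightarrow> bool" where
  "within_semicircle A \<longleftrightarrow>
     (\<exists>u w. norm u = 1 \<and> norm w = 1 \<and> u \<bullet> w = 0 \<and>
        (\<forall>x\<in>A. \<exists>s\<in>{0..pi}. x /\<^sub>R norm x = cos s *\<^sub>R u + sin s *\<^sub>R w))"

text \<open>
  The convention on S2xR for a figure consisting of geodesic arcs in the plane \<open>W\<close> through the
  centre: no arc exceeds a semicircle, and the figure as a whole does not go around the centre,
  i.e. it misses some fibre $\{cv : c > 0\}$ of \<open>W\<close>.  The plane without the centre is a flat
  cylinder; by the second clause the figure unrolls to the Euclidean plane, so that a chain of
  short arcs cannot close up around the cylinder.  Without it Menelaus' theorem fails: in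
  unrolled coordinates (angle, t) take $A_0=(0,0)$, $A_1=(0.1,0)$, $A_2=(0.17/2.2,\,0.085/2.2)$,
  and let \<open>l\<close> be the helix $t=2(\phi-1.5)$.  It meets $A_0A_1$ at angle $1.5$, $A_0A_2$ at
  angle $2$, and $A_1A_2$ at angle about $3.744-2\pi=-2.540$, all arcs being less than a semicircle,
  but the product of the ratios is about $-1.039$.
\<close>

definition semicircle_convention :: "geometry \<Rightarrow> (real^3) set \<Rightarrow> (real^3) set set \<Rightarrow> bool" where
  "semicircle_convention X W arcs \<longleftrightarrow> (X = S2xR \<longrightarrow>
     (\<forall>a\<in>arcs. within_semicircle a) \<and>
     (\<exists>v\<in>W. v \<noteq> 0 \<and> (\<forall>c>0. c *\<^sub>R v \<notin> \<Union>arcs)))"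


lemma vec3_has_vector_derivative:
  assumes "(f has_real_derivative f') (at s)" "(g has_real_derivative g') (at s)"
    "(h has_real_derivative h') (at s)"
  shows "((\<lambda>s. vector [f s, g s, h s] :: real^3) has_vector_derivative vector [f', g', h']) (at s)"
proof -
  have eq: "(vector [a, b, c] :: real^3) = a *\<^sub>R axis 1 1 + b *\<^sub>R axis 2 1 + c *\<^sub>R axis 3 1"
    for a b c :: real
    by (simp add: vec_eq_iff forall_3 axis_def)
  show ?thesis
    unfolding eq using assms
    by (auto intro!: derivative_eq_intros simp: has_real_derivative_iff_has_vector_derivative)
qed

lemma metric_S2xR_coordinates:
  fixes t \<phi> \<theta> :: "real \<Rightarrow> real"
  assumes "(t has_real_derivative t') (at s)" "(\<phi> has_real_derivative \<phi>') (at s)"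
    "(\<theta> has_real_derivative \<theta>') (at s)"
  defines "c \<equiv> \<lambda>s. vector [exp (t s) * cos (\<phi> s) * cos (\<theta> s),
                       exp (t s) * sin (\<phi> s) * cos (\<theta> s), exp (t s) * sin (\<theta> s)] :: real^3"
  shows "metric S2xR (c s) (vector_derivative c (at s)) = t'\<^sup>2 + (cos (\<theta> s))\<^sup>2 * \<phi>'\<^sup>2 + \<theta>'\<^sup>2"
proof -
  let ?E = "exp (t s)" and ?cp = "cos (\<phi> s)" and ?sp = "sin (\<phi> s)"
    and ?ct = "cos (\<theta> s)" and ?st = "sin (\<theta> s)"
  let ?v1 = "?E * (t' * ?cp * ?ct - \<phi>' * ?sp * ?ct - \<theta>' * ?cp * ?st)"
    and ?v2 = "?E * (t' * ?sp * ?ct + \<phi>' * ?cp * ?ct - \<theta>' * ?sp * ?st)"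
    and ?v3 = "?E * (t' * ?st + \<theta>' * ?ct)"
  have "(c has_vector_derivative vector [?v1, ?v2, ?v3]) (at s)"
    unfolding c_def
    by (rule vec3_has_vector_derivative;
        (auto intro!: derivative_eq_intros assms simp: algebra_simps))
  then have v: "vector_derivative c (at s) = vector [?v1, ?v2, ?v3]"
    by (rule vector_derivative_at)
  have 1: "?cp\<^sup>2 + ?sp\<^sup>2 = 1" "?ct\<^sup>2 + ?st\<^sup>2 = 1" by simp_all
  have pp: "(?E * ?cp * ?ct)\<^sup>2 + (?E * ?sp * ?ct)\<^sup>2 + (?E * ?st)\<^sup>2 = ?E\<^sup>2"
    using 1 by algebra
  have vv: "?v1\<^sup>2 + ?v2\<^sup>2 + ?v3\<^sup>2 = ?E\<^sup>2 * (t'\<^sup>2 + ?ct\<^sup>2 * \<phi>'\<^sup>2 + \<theta>'\<^sup>2)"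
    using 1 by algebra
  have "metric S2xR (c s) (vector_derivative c (at s)) =
      (?v1\<^sup>2 + ?v2\<^sup>2 + ?v3\<^sup>2) / ((?E * ?cp * ?ct)\<^sup>2 + (?E * ?sp * ?ct)\<^sup>2 + (?E * ?st)\<^sup>2)"
    by (simp only: metric.simps v) (simp add: c_def inner_vec_def sum_3 power2_eq_square)
  then show ?thesis unfolding pp vv by simp
qed

lemma metric_H2xR_coordinates:
  fixes t r \<alpha> :: "real \<Rightarrow> real"
  assumes "(t has_real_derivative t') (at s)" "(r has_real_derivative r') (at s)"
    "(\<alpha> has_real_derivative \<alpha>') (at s)"
  defines "c \<equiv> \<lambda>s. vector [exp (t s) * cosh (r s), exp (t s) * sinh (r s) * cos (\<alpha> s),
                       exp (t s) * sinh (r s) * sin (\<alpha> s)] :: real^3"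
  shows "metric H2xR (c s) (vector_derivative c (at s)) = t'\<^sup>2 + r'\<^sup>2 + (sinh (r s))\<^sup>2 * \<alpha>'\<^sup>2"
proof -
  let ?E = "exp (t s)" and ?ca = "cos (\<alpha> s)" and ?sa = "sin (\<alpha> s)"
    and ?ch = "cosh (r s)" and ?sh = "sinh (r s)"
  let ?v1 = "?E * (t' * ?ch + r' * ?sh)"
    and ?v2 = "?E * (t' * ?sh * ?ca + r' * ?ch * ?ca - \<alpha>' * ?sh * ?sa)"
    and ?v3 = "?E * (t' * ?sh * ?sa + r' * ?ch * ?sa + \<alpha>' * ?sh * ?ca)"
  have "(c has_vector_derivative vector [?v1, ?v2, ?v3]) (at s)"
    unfolding c_def
    by (rule vec3_has_vector_derivative;
        (auto intro!: derivative_eq_intros assms simp: algebra_simps))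
  then have v: "vector_derivative c (at s) = vector [?v1, ?v2, ?v3]"
    by (rule vector_derivative_at)
  have 1: "?ca\<^sup>2 + ?sa\<^sup>2 = 1" "?ch\<^sup>2 - ?sh\<^sup>2 = 1"
    by (simp_all add: cosh_square_eq)
  have c: "c s = vector [?E * ?ch, ?E * ?sh * ?ca, ?E * ?sh * ?sa]" by (simp add: c_def)
  have pp: "lorentz (c s) (c s) = ?E\<^sup>2"
    unfolding c lorentz_def vector_3 using 1 by algebra
  have pv: "lorentz (c s) (vector [?v1, ?v2, ?v3]) = ?E\<^sup>2 * t'"
    unfolding c lorentz_def vector_3 using 1 by algebra
  have vv: "lorentz (vector [?v1, ?v2, ?v3]) (vector [?v1, ?v2, ?v3]) =
      ?E\<^sup>2 * (t'\<^sup>2 - r'\<^sup>2 - ?sh\<^sup>2 * \<alpha>'\<^sup>2)"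
    unfolding lorentz_def vector_3 using 1 by algebra
  show ?thesis unfolding metric.simps v pp pv vv by simp
qed

end

theory Submission
  imports Defs
begin

text \<open>
  Write a point of \<open>X\<close> as \<open>exp t\<close> times a unit vector \<open>u\<close> of the sphere (hyperboloid).  The distance of
  two points is then the hypotenuse over the spherical (hyperbolic) distance of the directions and
  the difference of the heights \<open>t\<close>, and equality in the triangle inequality forces every geodesic
  to be a screw motion: \<open>t\<close> is affine in arc length and \<open>u\<close> runs along a great circle with constant
  speed.  Hence a plane through the centre, unrolled by (angle, \<open>t\<close>), is flat with straight lines as
  geodesics.  If \<open>h\<close> is an affine function vanishing on the line \<open>l\<close>, then the simply ratio in which \<open>l\<close>
  divides a side \<open>AB\<close> is \<open>- h A / h B\<close>, and the product of the three ratios is -1.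
\<close>

section \<open>The sphere and the hyperbolic plane\<close>

text \<open>Both geometries are treated at once through the sign \<open>curv X\<close>: multiplied
  by it, the bilinear form is positive definite on the tangent planes of the unit surface, in the
  Lorentzian case too. Since \<open>gdist\<close> is an infimum over curves and geodesics are
  defined by local minimality, the distance has to be computed before any geodesic is known; its
  lower bound comes from functions that increase along a curve by at most the length. Two obstacles
  come from the statement itself. The fibre type hypothesis confines the surface to
  \<open>W\<close>, but \<open>A1\<close>, which would need an infinite ratio, is not a point of the
  surface. It is reached as a limit of surface points, whose existence rests on the compactness of
  balls. On the sphere the plane minus the centre is a cylinder and can be unrolled only after a
  cut; the cut is made along a fibre that the figure misses, and all angles are read in one open
  period. The bound of a half turn on the arcs of the sides makes parameter differences there equal
  to distances.\<close>

definition form :: "geometry \<Rightarrow> real^3 \<Rightarrow> real^3 \<Rightarrow> real" where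
  "form X v w = (case X of S2xR \<Rightarrow> v \<bullet> w | H2xR \<Rightarrow> lorentz v w)"

definition curv :: "geometry \<Rightarrow> real" where
  "curv X = (case X of S2xR \<Rightarrow> 1 | H2xR \<Rightarrow> - 1)"

text \<open>\<open>cs\<close> and \<open>sn\<close> solve y'' = - \<open>curv X\<close> y with
  values 1, 0 and slopes 0, 1 at the origin. Addition theorems and derivatives depend on the
  geometry only through \<open>curv X\<close>.\<close>

definition cs :: "geometry \<Rightarrow> real \<Rightarrow> real" where
  "cs X = (case X of S2xR \<Rightarrow> cos | H2xR \<Rightarrow> cosh)"

definition sn :: "geometry \<Rightarrow> real \<Rightarrow> real" where
  "sn X = (case X of S2xR \<Rightarrow> sin | H2xR \<Rightarrow> sinh)"

definition acs :: "geometry \<Rightarrow> real \<Rightarrow> real" where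
  "acs X = (case X of S2xR \<Rightarrow> arccos | H2xR \<Rightarrow> arcosh)"

text \<open>The angles on which \<open>acs\<close> inverts \<open>cs\<close> up to sign: the unit
  sphere has diameter pi, the hyperbolic plane imposes no bound.\<close>

definition short :: "geometry \<Rightarrow> real \<Rightarrow> bool" where
  "short X \<theta> \<longleftrightarrow> (X = S2xR \<longrightarrow> \<bar>\<theta>\<bar> \<le> pi)"

text \<open>At exp t times a vector u with \<open>form X u u = 1\<close> the form has the value exp
  (2 t), so this recovers the fibre coordinate t.\<close>

definition height :: "geometry \<Rightarrow> real^3 \<Rightarrow> real" where
  "height X p = ln (form X p p) / 2"

definition dir :: "geometry \<Rightarrow> real^3 \<Rightarrow> real^3" where
  "dir X p = p /\<^sub>R sqrt (form X p p)"

definition unit_points :: "geometry \<Rightarrow> (real^3) set" where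
  "unit_points X = {u \<in> points X. form X u u = 1}"

lemma curv_cases: "curv X = 1 \<or> curv X = - 1"
  by (cases X) (auto simp: curv_def)

lemma curv_square [simp]: "curv X * curv X = 1" "(curv X)\<^sup>2 = 1"
  by (cases X; simp add: curv_def)+

lemma curv_mult_square [simp]: "curv X * (curv X * a) = a"
  by (cases X) (simp_all add: curv_def)

lemma bilinear_form: "bilinear (form X)"
  by (cases X) (auto simp: bilinear_def form_def lorentz_def algebra_simps inner_simps intro!: linearI)

lemmas form_bilinear_simps =
  bilinear_ladd[OF bilinear_form] bilinear_radd[OF bilinear_form]
  bilinear_lsub[OF bilinear_form] bilinear_rsub[OF bilinear_form]
  bilinear_lmul[OF bilinear_form] bilinear_rmul[OF bilinear_form]
  bilinear_lneg[OF bilinear_form] bilinear_rneg[OF bilinear_form]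
  bilinear_lzero[OF bilinear_form] bilinear_rzero[OF bilinear_form]

lemma form_commute: "form X v w = form X w v"
  by (cases X) (auto simp: form_def lorentz_def inner_commute)

lemma bounded_bilinear_form: "bounded_bilinear (form X)"
  using bilinear_form by (simp add: bilinear_conv_bounded_bilinear)

lemmas continuous_on_form [continuous_intros] =
  bounded_bilinear.continuous_on[OF bounded_bilinear_form]

lemma form_has_real_derivative [derivative_intros]:
  assumes "(f has_vector_derivative f') (at s within A)" "(g has_vector_derivative g') (at s within A)"
  shows "((\<lambda>s. form X (f s) (g s)) has_real_derivative (form X (f s) g' + form X f' (g s))) (at s within A)"
  using bounded_bilinear.has_vector_derivative[OF bounded_bilinear_form assms]
  by (simp add: has_real_derivative_iff_has_vector_derivative)

section \<open>Trigonometry of constant curvature 1 and -1\<close>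

lemma cs_0 [simp]: "cs X 0 = 1" and sn_0 [simp]: "sn X 0 = 0"
  by (cases X; simp add: cs_def sn_def)+

lemma cs_minus [simp]: "cs X (- a) = cs X a" and sn_minus [simp]: "sn X (- a) = - sn X a"
  by (cases X; simp add: cs_def sn_def)+

lemma cs_abs [simp]: "cs X \<bar>a\<bar> = cs X a"
  by (simp add: abs_if)

lemma cs_add: "cs X (a + b) = cs X a * cs X b - curv X * sn X a * sn X b"
  by (cases X) (simp_all add: cs_def sn_def curv_def cos_add cosh_add)

lemma sn_add: "sn X (a + b) = sn X a * cs X b + cs X a * sn X b"
  by (cases X) (simp_all add: cs_def sn_def curv_def sin_add sinh_add)

lemma cs_diff: "cs X (a - b) = cs X a * cs X b + curv X * sn X a * sn X b"
  using cs_add[of X a "- b"] by simp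

lemma sn_diff: "sn X (a - b) = sn X a * cs X b - cs X a * sn X b"
  using sn_add[of X a "- b"] by simp

lemma cs_sn_square: "(cs X a)\<^sup>2 + curv X * (sn X a)\<^sup>2 = 1"
  by (cases X) (simp_all add: cs_def sn_def curv_def cosh_square_eq)

lemma curv_sn_square: "curv X * (1 - (cs X a)\<^sup>2) = (sn X a)\<^sup>2"
  using cs_sn_square[of X a] by (cases X) (auto simp: curv_def)

lemma cs_has_real_derivative [derivative_intros]:
  assumes "(f has_real_derivative f') (at s within A)"
  shows "((\<lambda>s. cs X (f s)) has_real_derivative (- curv X * sn X (f s) * f')) (at s within A)"
  by (cases X) (auto simp: cs_def sn_def curv_def intro!: derivative_eq_intros assms)

lemma sn_has_real_derivative [derivative_intros]:
  assumes "(f has_real_derivative f') (at s within A)"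
  shows "((\<lambda>s. sn X (f s)) has_real_derivative (cs X (f s) * f')) (at s within A)"
  by (cases X) (auto simp: cs_def sn_def curv_def intro!: derivative_eq_intros assms)

lemma continuous_on_cs [continuous_intros]:
  fixes f :: "'a::t2_space \<Rightarrow> real"
  shows "continuous_on A f \<Longrightarrow> continuous_on A (\<lambda>s. cs X (f s))"
  by (cases X) (auto simp: cs_def intro: continuous_intros)

lemma continuous_on_sn [continuous_intros]:
  fixes f :: "'a::t2_space \<Rightarrow> real"
  shows "continuous_on A f \<Longrightarrow> continuous_on A (\<lambda>s. sn X (f s))"
  by (cases X) (auto simp: sn_def intro: continuous_intros)

lemma acs_cs: "short X \<theta> \<Longrightarrow> acs X (cs X \<theta>) = \<bar>\<theta>\<bar>"
  by (cases X) (auto simp: acs_def cs_def short_def arccos_cos arccos_cos2 arcosh_cosh_real abs_if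
      arcosh_cosh_real[of "-\<theta>", simplified])

lemma cs_acs: "x \<in> range (cs X) \<Longrightarrow> cs X (acs X x) = x"
  by (cases X) (auto simp: acs_def cs_def cos_arccos_abs abs_le_iff cosh_real_ge_1)

lemma acs_nonneg: "x \<in> range (cs X) \<Longrightarrow> 0 \<le> acs X x"
  by (cases X) (auto simp: acs_def cs_def arccos_lbound cosh_real_ge_1)

lemma short_acs: "x \<in> range (cs X) \<Longrightarrow> short X (acs X x)"
  by (cases X) (auto simp: acs_def cs_def short_def arccos_lbound arccos_ubound)

lemma acs_1 [simp]: "acs X 1 = 0"
  by (cases X) (auto simp: acs_def)

lemma sn_nonneg: "0 \<le> \<theta> \<Longrightarrow> short X \<theta> \<Longrightarrow> 0 \<le> sn X \<theta>"
  by (cases X) (auto simp: sn_def short_def sin_ge_zero)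

lemma sn_pos: "0 < \<theta> \<Longrightarrow> (X = S2xR \<longrightarrow> \<theta> < pi) \<Longrightarrow> 0 < sn X \<theta>"
  by (cases X) (auto simp: sn_def short_def sin_gt_zero)

text \<open>cos decreases on [0, pi] and cosh increases on the nonnegative reals; the sign
  \<open>curv X\<close> makes both decreasing.\<close>

lemma curv_cs_le_imp_le:
  assumes "0 \<le> a" "short X a" "0 \<le> b" "short X b" "curv X * cs X b \<le> curv X * cs X a"
  shows "a \<le> b"
  using assms by (cases X) (auto simp: curv_def cs_def short_def cos_mono_le_eq cosh_real_nonneg_le_iff)

section \<open>Definiteness of the form on orthogonal complements\<close>

lemma points_form_pos: "p \<in> points X \<Longrightarrow> 0 < form X p p"
  by (cases X) (auto simp: form_def)

text \<open>The complement of a timelike vector is spacelike. Orthogonality expresses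
  \<open>u$1 * x$1\<close> through the last two coordinates; Cauchy-Schwarz there bounds its square
  by a b, where a is less than the square of \<open>u$1\<close>. Equality leaves only b = 0.\<close>

lemma lorentz_orthogonal_nonpos:
  assumes "u$1 > 0" "lorentz u u > 0" "lorentz u x = 0"
  shows "lorentz x x \<le> 0" "lorentz x x = 0 \<Longrightarrow> x = 0"
proof -
  define a where "a = (u$2)\<^sup>2 + (u$3)\<^sup>2"
  define b where "b = (x$2)\<^sup>2 + (x$3)\<^sup>2"
  have a: "(u$1)\<^sup>2 > a" "a \<ge> 0" "b \<ge> 0"
    using assms by (auto simp: lorentz_def a_def b_def power2_eq_square)
  have "u$1 * x$1 = u$2 * x$2 + u$3 * x$3"
    using assms(3) by (simp add: lorentz_def)
  then have "(u$1)\<^sup>2 * (x$1)\<^sup>2 = (u$2 * x$2 + u$3 * x$3)\<^sup>2"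
    by (metis power_mult_distrib)
  also have "\<dots> \<le> a * b"
    using zero_le_power2[of "u$2 * x$3 - u$3 * x$2"] unfolding a_def b_def
    by (simp add: power2_eq_square algebra_simps)
  finally have *: "(u$1)\<^sup>2 * (x$1)\<^sup>2 \<le> a * b" .
  also have "\<dots> \<le> (u$1)\<^sup>2 * b"
    using a by (intro mult_right_mono) auto
  finally have "(x$1)\<^sup>2 \<le> b"
    using a assms(1) by simp
  moreover have L: "lorentz x x = (x$1)\<^sup>2 - b"
    by (simp add: lorentz_def b_def power2_eq_square)
  ultimately show "lorentz x x \<le> 0" by simp
  assume "lorentz x x = 0"
  with L have e: "(x$1)\<^sup>2 = b" by simp
  with * have "((u$1)\<^sup>2 - a) * b \<le> 0" by (simp add: algebra_simps)
  with a have "b = 0"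
    by (smt (verit) mult_pos_pos)
  with e have "x$1 = 0" "x$2 = 0" "x$3 = 0"
    by (auto simp: b_def sum_power2_eq_zero_iff)
  then show "x = 0" by (simp add: vec_eq_iff forall_3)
qed

lemma form_orthogonal_nonneg:
  assumes "u \<in> points X" "form X u x = 0"
  shows "0 \<le> curv X * form X x x"
  using assms lorentz_orthogonal_nonpos(1)[of u x] by (cases X) (auto simp: curv_def form_def)

lemma form_orthogonal_eq_0:
  assumes "u \<in> points X" "form X u x = 0" "form X x x = 0"
  shows "x = 0"
  using assms lorentz_orthogonal_nonpos(2)[of u x] by (cases X) (auto simp: form_def)

text \<open>On the complement of u the form is definite up to the sign \<open>curv X\<close>, so the
  usual argument applies: subtract from x its projection to y. The sign enters twice and
  cancels.\<close>

lemma form_orthogonal_Cauchy_Schwarz: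
  assumes "u \<in> points X" "form X u x = 0" "form X u y = 0"
  shows "(form X x y)\<^sup>2 \<le> form X x x * form X y y"
proof (cases "form X y y = 0")
  case True
  then have "y = 0" using form_orthogonal_eq_0 assms by blast
  then show ?thesis by (simp add: form_bilinear_simps)
next
  case False
  let ?k = "form X x y / form X y y"
  have "0 \<le> curv X * form X (x - ?k *\<^sub>R y) (x - ?k *\<^sub>R y)"
    using assms by (intro form_orthogonal_nonneg[of u]) (auto simp: form_bilinear_simps)
  also have "form X (x - ?k *\<^sub>R y) (x - ?k *\<^sub>R y) = form X x x - (form X x y)\<^sup>2 / form X y y"
    using False form_commute[of X x y] by (simp add: form_bilinear_simps field_simps power2_eq_square)
  finally have "0 \<le> (curv X * form X y y) * (curv X * (form X x x - (form X x y)\<^sup>2 / form X y y))"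
    using form_orthogonal_nonneg[OF assms(1,3)] by simp
  also have "\<dots> = form X x x * form X y y - (form X x y)\<^sup>2"
    using False by (simp add: field_simps)
  finally show ?thesis by simp
qed

text \<open>In the open future cone the product of the spatial parts is bounded by the product of
  their lengths, and each length is smaller than the corresponding first coordinate.\<close>

lemma lorentz_pos:
  assumes "u$1 > 0" "lorentz u u > 0" "v$1 > 0" "lorentz v v > 0"
  shows "lorentz u v > 0"
proof -
  define a where "a = (u$2)\<^sup>2 + (u$3)\<^sup>2"
  define b where "b = (v$2)\<^sup>2 + (v$3)\<^sup>2"
  have "(u$2 * v$2 + u$3 * v$3)\<^sup>2 \<le> a * b"
    using zero_le_power2[of "u$2 * v$3 - u$3 * v$2"] unfolding a_def b_def
    by (simp add: power2_eq_square algebra_simps)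
  also have "\<dots> < (u$1)\<^sup>2 * (v$1)\<^sup>2"
    using assms by (intro mult_strict_mono') (auto simp: lorentz_def a_def b_def power2_eq_square)
  also have "\<dots> = (u$1 * v$1)\<^sup>2" by (simp add: power_mult_distrib)
  finally have "\<bar>u$2 * v$2 + u$3 * v$3\<bar> < u$1 * v$1"
    using assms by (intro power2_less_imp_less[of "\<bar>_\<bar>"]) auto
  then show ?thesis by (auto simp: lorentz_def)
qed

text \<open>The sign condition selects the future sheet: if v lay in the past cone, - v would lie in
  the future cone and pair positively with u.\<close>

lemma points_if_form_pos:
  assumes "u \<in> points X" "form X v v > 0" "X = H2xR \<Longrightarrow> form X u v > 0"
  shows "v \<in> points X"
proof (cases X)
  case S2xR
  with assms show ?thesis by (auto simp: form_def)
next
  case H2xR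
  have "v$1 > 0"
  proof (rule ccontr)
    assume "\<not> v$1 > 0"
    moreover have "(v$2)\<^sup>2 + (v$3)\<^sup>2 < (v$1)\<^sup>2"
      using assms(2) H2xR by (simp add: form_def lorentz_def power2_eq_square)
    then have "v$1 \<noteq> 0"
      by (metis zero_power2 not_sum_power2_lt_zero)
    ultimately have "(- v)$1 > 0" by simp
    moreover have "lorentz (- v) (- v) = lorentz v v" "lorentz u (- v) = - lorentz u v"
      by (simp_all add: lorentz_def)
    ultimately show False
      using assms H2xR lorentz_pos[of u "- v"] by (simp add: form_def)
  qed
  with assms H2xR show ?thesis by (auto simp: form_def)
qed

lemma form_points_pos_H2xR: "u \<in> points H2xR \<Longrightarrow> v \<in> points H2xR \<Longrightarrow> form H2xR u v > 0"
  by (simp add: form_def lorentz_pos)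

text \<open>Splits v at u into a multiple of u and a tangent vector. The square of the latter is, up
  to \<open>curv X\<close>, the squared \<open>sn\<close> of the distance.\<close>

lemma unit_form_diff:
  assumes "form X u u = 1" "form X v v = 1"
  shows "form X (v - form X u v *\<^sub>R u) (v - form X u v *\<^sub>R u) = 1 - (form X u v)\<^sup>2"
    and "form X u (v - form X u v *\<^sub>R u) = 0"
  using assms form_commute[of X u v] by (simp_all add: form_bilinear_simps power2_eq_square)

lemma unit_points_form_bound:
  assumes "u \<in> unit_points X" "v \<in> unit_points X"
  shows "0 \<le> curv X * (1 - (form X u v)\<^sup>2)"
  using form_orthogonal_nonneg[of u X "v - form X u v *\<^sub>R u"] unit_form_diff[of X u v] assms
  by (simp add: unit_points_def)

lemma unit_points_form_range:
  assumes "u \<in> unit_points X" "v \<in> unit_points X"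
  shows "form X u v \<in> range (cs X)"
proof (cases X)
  case S2xR
  then have "\<bar>form X u v\<bar> \<le> 1"
    using unit_points_form_bound[OF assms] by (simp add: curv_def abs_square_le_1)
  then have "form X u v = cos (arccos (form X u v))" by (simp add: abs_le_iff)
  then show ?thesis unfolding cs_def S2xR geometry.case by (rule range_eqI)
next
  case H2xR
  have "1\<^sup>2 \<le> (form X u v)\<^sup>2" using unit_points_form_bound[OF assms] H2xR by (simp add: curv_def)
  moreover have "0 < form X u v"
    using assms form_points_pos_H2xR H2xR by (auto simp: unit_points_def)
  ultimately have "1 \<le> form X u v" by (rule power2_le_imp_le[OF _ less_imp_le])
  then have "form X u v = cosh (arcosh (form X u v))" by simp
  then show ?thesis unfolding cs_def H2xR geometry.case by (rule range_eqI)
qed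

lemma unit_points_eqI:
  assumes "u \<in> unit_points X" "v \<in> unit_points X" "form X u v = 1"
  shows "u = v"
  using form_orthogonal_eq_0[of u X "v - form X u v *\<^sub>R u"] unit_form_diff[of X u v] assms
  by (simp add: unit_points_def)

section \<open>Decomposition of a point into height and direction\<close>

lemma dir_unit_points:
  assumes "p \<in> points X"
  shows "dir X p \<in> unit_points X"
proof -
  have pos: "form X p p > 0" using assms points_form_pos by blast
  have f: "form X (dir X p) (dir X p) = 1"
    using pos by (simp add: dir_def form_bilinear_simps field_simps flip: power2_eq_square)
  moreover have "form X p (dir X p) > 0"
    using pos by (simp add: dir_def form_bilinear_simps)
  ultimately have "dir X p \<in> points X"
    using f by (intro points_if_form_pos[OF assms]) auto
  with f show ?thesis by (simp add: unit_points_def)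
qed

lemma points_eq_height_dir:
  assumes "p \<in> points X"
  shows "p = exp (height X p) *\<^sub>R dir X p"
proof -
  have pos: "form X p p > 0" using assms points_form_pos by blast
  have "exp (height X p) = sqrt (form X p p)"
    using pos unfolding height_def by (subst ln_sqrt[symmetric]) auto
  then show ?thesis using pos by (simp add: dir_def)
qed

lemma scaled_unit_point:
  assumes "u \<in> unit_points X"
  shows "exp t *\<^sub>R u \<in> points X" "height X (exp t *\<^sub>R u) = t" "dir X (exp t *\<^sub>R u) = u"
proof -
  have f: "form X (exp t *\<^sub>R u) (exp t *\<^sub>R u) = (exp t)\<^sup>2"
    using assms by (simp add: unit_points_def form_bilinear_simps power2_eq_square)
  have "form X u (exp t *\<^sub>R u) > 0" using assms by (simp add: unit_points_def form_bilinear_simps)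
  then show "exp t *\<^sub>R u \<in> points X"
    using f assms by (intro points_if_form_pos[of u X "exp t *\<^sub>R u"]) (auto simp: unit_points_def)
  show "height X (exp t *\<^sub>R u) = t" by (simp add: height_def f ln_realpow)
  show "dir X (exp t *\<^sub>R u) = u" by (simp add: dir_def f)
qed

definition unit_dist :: "geometry \<Rightarrow> real^3 \<Rightarrow> real^3 \<Rightarrow> real" where
  "unit_dist X u v = acs X (form X u v)"

lemma unit_dist_nonneg: "u \<in> unit_points X \<Longrightarrow> v \<in> unit_points X \<Longrightarrow> 0 \<le> unit_dist X u v"
  and unit_dist_short: "u \<in> unit_points X \<Longrightarrow> v \<in> unit_points X \<Longrightarrow> short X (unit_dist X u v)"
  and cs_unit_dist: "u \<in> unit_points X \<Longrightarrow> v \<in> unit_points X \<Longrightarrow> cs X (unit_dist X u v) = form X u v"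
  by (simp_all add: unit_dist_def acs_nonneg short_acs cs_acs unit_points_form_range)

lemma unit_dist_commute: "unit_dist X u v = unit_dist X v u"
  by (simp add: unit_dist_def form_commute)

lemma unit_dist_eq_0:
  assumes "u \<in> unit_points X" "v \<in> unit_points X"
  shows "unit_dist X u v = 0 \<longleftrightarrow> u = v"
proof
  assume "unit_dist X u v = 0"
  then show "u = v" using cs_unit_dist[OF assms] unit_points_eqI[OF assms] by simp
qed (use assms in \<open>simp add: unit_dist_def unit_points_def\<close>)

lemma sn_unit_dist_square:
  assumes "u \<in> unit_points X" "v \<in> unit_points X"
  shows "(sn X (unit_dist X u v))\<^sup>2 = curv X * (1 - (form X u v)\<^sup>2)"
  using curv_sn_square[of X "unit_dist X u v"] cs_unit_dist[OF assms] by simp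

text \<open>At v the tangent parts of u and w have lengths sn a and sn b, so Cauchy-Schwarz bounds
  the angle term in the law of cosines and yields
  \<open>curv X * cs X (a + b) \<le> curv X * form X u w\<close>. If a + b exceeds pi on the sphere
  the claim is trivial, since no distance exceeds pi.\<close>

lemma unit_dist_triangle:
  assumes u: "u \<in> unit_points X" and v: "v \<in> unit_points X" and w: "w \<in> unit_points X"
  shows "unit_dist X u w \<le> unit_dist X u v + unit_dist X v w"
proof (cases "short X (unit_dist X u v + unit_dist X v w)")
  case False
  then show ?thesis
    using unit_dist_short[OF u w] unit_dist_nonneg[OF u v] unit_dist_nonneg[OF v w]
    by (auto simp: short_def)
next
  case True
  let ?a = "unit_dist X u v" and ?b = "unit_dist X v w"
  let ?x = "form X v u" and ?y = "form X v w"
  let ?u = "u - ?x *\<^sub>R v" and ?w = "w - ?y *\<^sub>R v"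
  have 1: "form X u u = 1" "form X v v = 1" "form X w w = 1" "v \<in> points X"
    using assms by (auto simp: unit_points_def)
  have uw: "form X ?u ?w = form X u w - ?x * ?y"
    using 1 form_commute[of X u v] by (simp add: form_bilinear_simps)
  have a: "(sn X ?a)\<^sup>2 = curv X * (1 - ?x\<^sup>2)"
    using sn_unit_dist_square[OF v u] by (simp add: unit_dist_commute)
  have b: "(sn X ?b)\<^sup>2 = curv X * (1 - ?y\<^sup>2)"
    using sn_unit_dist_square[OF v w] .
  have "(form X u w - ?x * ?y)\<^sup>2 \<le> form X ?u ?u * form X ?w ?w"
    using form_orthogonal_Cauchy_Schwarz[of v X ?u ?w] unit_form_diff 1 uw by simp
  also have "\<dots> = (1 - ?x\<^sup>2) * (1 - ?y\<^sup>2)"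
    using unit_form_diff 1 by simp
  also have "\<dots> = (sn X ?a * sn X ?b)\<^sup>2"
    unfolding power_mult_distrib a b using curv_square(1)[of X] by algebra
  finally have "\<bar>form X u w - ?x * ?y\<bar> \<le> sn X ?a * sn X ?b"
    by (intro power2_le_imp_le[of "\<bar>_\<bar>"])
      (simp_all add: sn_nonneg unit_dist_nonneg unit_dist_short u v w)
  then have 2: "- (sn X ?a * sn X ?b) \<le> curv X * (form X u w - ?x * ?y)"
    using curv_cases[of X] by (elim disjE) auto
  have "cs X ?a = ?x" "cs X ?b = ?y"
    by (simp_all only: cs_unit_dist u v w form_commute[of X u v])
  then have "curv X * cs X (?a + ?b) = curv X * (?x * ?y) - sn X ?a * sn X ?b"
    by (simp only: cs_add right_diff_distrib mult.assoc curv_mult_square)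
  also have "\<dots> \<le> curv X * form X u w"
    using 2 by (simp only: right_diff_distrib)
  also have "\<dots> = curv X * cs X (unit_dist X u w)"
    by (simp only: cs_unit_dist u w)
  finally show ?thesis
    using True unit_dist_nonneg[OF u v] unit_dist_nonneg[OF v w] unit_dist_nonneg[OF u w]
      unit_dist_short[OF u w]
    by (intro curv_cs_le_imp_le[of "unit_dist X u w" X]) simp_all
qed

section \<open>Rotations in the factor surface\<close>

text \<open>As dt(v) is \<open>form X p v / form X p p\<close>, the first summand is the square of
  dt and the second, made nonnegative by \<open>curv X\<close>, is the squared speed of the
  direction.\<close>

lemma metric_form:
  "metric X p v = (form X p v / form X p p)\<^sup>2
    + curv X * (form X v v / form X p p - (form X p v / form X p p)\<^sup>2)"
  by (cases X) (simp_all add: form_def curv_def)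

text \<open>The value \<open>curv X\<close> makes w a unit tangent vector at u for the Riemannian
  metric \<open>curv X * form X\<close> of the factor surface.\<close>

definition frame :: "geometry \<Rightarrow> real^3 \<Rightarrow> real^3 \<Rightarrow> bool" where
  "frame X u w \<longleftrightarrow> u \<in> unit_points X \<and> form X u w = 0 \<and> form X w w = curv X"

definition rot :: "geometry \<Rightarrow> real^3 \<Rightarrow> real^3 \<Rightarrow> real \<Rightarrow> real^3" where
  "rot X u w \<theta> = cs X \<theta> *\<^sub>R u + sn X \<theta> *\<^sub>R w"

lemma form_rot_rot:
  assumes "frame X u w"
  shows "form X (rot X u w a) (rot X u w b) = cs X (a - b)"
  using assms by (simp add: frame_def unit_points_def rot_def form_bilinear_simps form_commute[of X w u]
      cs_diff algebra_simps)

lemma rot_0 [simp]: "rot X u w 0 = u"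
  by (simp add: rot_def)

lemma rot_unit_points:
  assumes "frame X u w"
  shows "rot X u w \<theta> \<in> unit_points X"
proof -
  have u: "u \<in> points X" using assms by (simp add: frame_def unit_points_def)
  have 1: "form X (rot X u w \<theta>) (rot X u w \<theta>) = 1"
    using form_rot_rot[OF assms, of \<theta> \<theta>] by simp
  have "form X u (rot X u w \<theta>) = cs X \<theta>"
    using form_rot_rot[OF assms, of 0 \<theta>] by simp
  then have "X = H2xR \<Longrightarrow> 0 < form X u (rot X u w \<theta>)"
    by (simp add: cs_def)
  then have "rot X u w \<theta> \<in> points X"
    using 1 by (intro points_if_form_pos[OF u]) simp_all
  with 1 show ?thesis by (simp add: unit_points_def)
qed

lemma unit_dist_rot:
  assumes "frame X u w" "short X (a - b)"
  shows "unit_dist X (rot X u w a) (rot X u w b) = \<bar>a - b\<bar>"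
  using acs_cs[OF assms(2)] by (simp add: unit_dist_def form_rot_rot[OF assms(1)])

lemma frame_normalize:
  assumes "u \<in> unit_points X" "form X u x = 0" "x \<noteq> 0"
  shows "\<exists>a. frame X u (a *\<^sub>R x)"
proof -
  have "u \<in> points X" using assms by (simp add: unit_points_def)
  then have "0 < curv X * form X x x"
    using form_orthogonal_nonneg[of u X x] form_orthogonal_eq_0[of u X x] assms
    by (metis curv_mult_square less_le mult_zero_right)
  then have "frame X u ((1 / sqrt (curv X * form X x x)) *\<^sub>R x)"
    using assms curv_cases[of X] by (auto simp: frame_def form_bilinear_simps real_div_sqrt field_simps)
  then show ?thesis by blast
qed

lemma frame_exists:
  assumes "u \<in> unit_points X"
  shows "\<exists>w. frame X u w"
proof -
  \<comment> \<open>Any vector off the line of u serves; the two choices cover u on the first axis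
    and u off it.\<close>
  define x :: "real^3" where "x = (if u$2 = 0 \<and> u$3 = 0 then axis 2 1 else axis 1 1)"
  have "x - form X u x *\<^sub>R u \<noteq> 0"
  proof
    assume *: "x - form X u x *\<^sub>R u = 0"
    then have "x$i = form X u x * u$i" for i
      by (metis eq_iff_diff_eq_0 vector_scaleR_component real_scaleR_def)
    from this[of 1] this[of 2] this[of 3] show False
      by (auto simp: x_def axis_def split: if_splits)
  qed
  moreover have "form X u (x - form X u x *\<^sub>R u) = 0"
    using assms by (simp add: unit_points_def form_bilinear_simps)
  ultimately show ?thesis using frame_normalize[OF assms] by blast
qed

text \<open>w is the normalised tangent part of v at u. When that part vanishes, v is u or - u, and
  every unit tangent vector serves.\<close>

lemma rot_connect:
  assumes u: "u \<in> unit_points X" and v: "v \<in> unit_points X"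
  shows "\<exists>w. frame X u w \<and> v = rot X u w (unit_dist X u v)"
proof -
  let ?x = "form X u v" and ?s = "sn X (unit_dist X u v)"
  let ?y = "v - ?x *\<^sub>R u"
  have y: "form X ?y ?y = curv X * ?s\<^sup>2" "form X u ?y = 0"
    using unit_form_diff[of X u v] u v sn_unit_dist_square[OF u v] by (simp_all add: unit_points_def)
  have c: "cs X (unit_dist X u v) = ?x" using cs_unit_dist[OF u v] .
  show ?thesis
  proof (cases "?s = 0")
    case True
    then have "?y = 0"
      using y u form_orthogonal_eq_0[of u X ?y] by (simp add: unit_points_def)
    then have "v = rot X u w (unit_dist X u v)" for w
      using True c by (simp add: rot_def)
    then show ?thesis using frame_exists[OF u] by blast
  next
    case False
    then have "frame X u ((1 / ?s) *\<^sub>R ?y)"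
      using y u by (simp add: frame_def bilinear_lmul[OF bilinear_form] bilinear_rmul[OF bilinear_form]
          power2_eq_square)
    moreover have "v = rot X u ((1 / ?s) *\<^sub>R ?y) (unit_dist X u v)"
      using False c by (simp add: rot_def)
    ultimately show ?thesis by blast
  qed
qed

text \<open>A helix over the great circle (or hyperbolic line) of u and w, with angular speed
  \<omega> and climb \<tau> along the fibre.\<close>

definition screw :: "geometry \<Rightarrow> real^3 \<Rightarrow> real^3 \<Rightarrow> real \<Rightarrow> real \<Rightarrow> real \<Rightarrow> real \<Rightarrow> real^3" where
  "screw X u w \<omega> \<tau> t s = exp (t + \<tau> * s) *\<^sub>R rot X u w (\<omega> * s)"

lemma screw_points:
  assumes "frame X u w"
  shows "screw X u w \<omega> \<tau> t s \<in> points X" "height X (screw X u w \<omega> \<tau> t s) = t + \<tau> * s"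
    "dir X (screw X u w \<omega> \<tau> t s) = rot X u w (\<omega> * s)"
  using scaled_unit_point[OF rot_unit_points[OF assms]] by (simp_all add: screw_def)

definition screw_deriv :: "geometry \<Rightarrow> real^3 \<Rightarrow> real^3 \<Rightarrow> real \<Rightarrow> real \<Rightarrow> real \<Rightarrow> real \<Rightarrow> real^3" where
  "screw_deriv X u w \<omega> \<tau> t s = exp (t + \<tau> * s) *\<^sub>R
    (\<tau> *\<^sub>R rot X u w (\<omega> * s) + \<omega> *\<^sub>R (cs X (\<omega> * s) *\<^sub>R w - (curv X * sn X (\<omega> * s)) *\<^sub>R u))"

lemma screw_has_vector_derivative:
  "(screw X u w \<omega> \<tau> t has_vector_derivative screw_deriv X u w \<omega> \<tau> t s) (at s)"
  unfolding screw_def[abs_def] rot_def screw_deriv_def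
  by (auto intro!: derivative_eq_intros simp: algebra_simps)

lemma metric_screw:
  assumes "frame X u w"
  shows "metric X (screw X u w \<omega> \<tau> t s) (screw_deriv X u w \<omega> \<tau> t s) = \<omega>\<^sup>2 + \<tau>\<^sup>2"
proof -
  let ?E = "exp (t + \<tau> * s)" and ?m = "rot X u w (\<omega> * s)"
  \<comment> \<open>The derivative of \<open>?m\<close> by the angle: a unit tangent vector at
    \<open>?m\<close>.\<close>
  let ?n = "cs X (\<omega> * s) *\<^sub>R w - (curv X * sn X (\<omega> * s)) *\<^sub>R u"
  have mm: "form X ?m ?m = 1" using form_rot_rot[OF assms] by simp
  have f: "form X u u = 1" "form X u w = 0" "form X w u = 0" "form X w w = curv X"
    using assms form_commute[of X w u] by (auto simp: frame_def unit_points_def)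
  have mn: "form X ?m ?n = 0" "form X ?n ?m = 0"
    by (simp_all add: rot_def form_bilinear_simps f)
  have "form X ?n ?n = curv X * ((cs X (\<omega> * s))\<^sup>2 + curv X * (sn X (\<omega> * s))\<^sup>2)"
    by (simp add: form_bilinear_simps f algebra_simps power2_eq_square)
  then have nn: "form X ?n ?n = curv X" by (simp add: cs_sn_square)
  have "form X (screw X u w \<omega> \<tau> t s) (screw X u w \<omega> \<tau> t s) = ?E\<^sup>2"
    by (simp add: screw_def form_bilinear_simps mm power2_eq_square)
  moreover have "form X (screw X u w \<omega> \<tau> t s) (screw_deriv X u w \<omega> \<tau> t s) = ?E\<^sup>2 * \<tau>"
    unfolding screw_def screw_deriv_def
    by (simp add: bilinear_ladd[OF bilinear_form] bilinear_radd[OF bilinear_form]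
        bilinear_lmul[OF bilinear_form] bilinear_rmul[OF bilinear_form] mm mn power2_eq_square)
  moreover have "form X (screw_deriv X u w \<omega> \<tau> t s) (screw_deriv X u w \<omega> \<tau> t s) = ?E\<^sup>2 * (\<tau>\<^sup>2 + curv X * \<omega>\<^sup>2)"
    unfolding screw_deriv_def
    by (simp only: bilinear_ladd[OF bilinear_form] bilinear_radd[OF bilinear_form]
        bilinear_lmul[OF bilinear_form] bilinear_rmul[OF bilinear_form] mm mn nn)
      (simp add: power2_eq_square algebra_simps)
  ultimately show ?thesis
    by (simp add: metric_form)
qed

lemma curve_length_screw:
  assumes "frame X u w" "a \<le> b"
  shows "curve_length X (screw X u w \<omega> \<tau> t) a b = sqrt (\<omega>\<^sup>2 + \<tau>\<^sup>2) * (b - a)"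
  using assms(2)
  by (simp add: curve_length_def vector_derivative_at[OF screw_has_vector_derivative] metric_screw[OF assms(1)])

lemma screw_C1: "screw X u w \<omega> \<tau> t C1_differentiable_on S"
  unfolding C1_differentiable_on_def
  proof (intro exI conjI ballI)
  show "continuous_on S (screw_deriv X u w \<omega> \<tau> t)"
    unfolding screw_deriv_def[abs_def] rot_def by (intro continuous_intros)
qed (rule screw_has_vector_derivative)

text \<open>The condition on k means k < 1 on the sphere and k > 1 in the hyperbolic plane. Either
  way k x avoids the end points of the domain, where the slope of \<open>acs\<close> is
  infinite.\<close>

lemma acs_has_real_derivative:
  assumes "x \<in> range (cs X)" "0 < k" "0 < curv X * (1 - k\<^sup>2)"
  shows "0 < curv X * (1 - (k * x)\<^sup>2)"
    and "(acs X has_real_derivative - curv X / sqrt (curv X * (1 - (k * x)\<^sup>2))) (at (k * x))"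
proof -
  have "0 < curv X * (1 - (k * x)\<^sup>2) \<and>
    (acs X has_real_derivative - curv X / sqrt (curv X * (1 - (k * x)\<^sup>2))) (at (k * x))"
  proof (cases X)
    case S2xR
    have k: "k < 1" using assms S2xR by (simp add: curv_def abs_square_less_1)
    have "\<bar>x\<bar> \<le> 1" using assms S2xR by (auto simp: cs_def)
    then have "\<bar>k\<bar> * \<bar>x\<bar> \<le> \<bar>k\<bar>" by (intro mult_left_le) auto
    then have *: "\<bar>k * x\<bar> < 1" using k assms(2) unfolding abs_mult by linarith
    then have "(k * x)\<^sup>2 < 1" by (simp add: abs_square_less_1)
    with * show ?thesis using S2xR DERIV_arccos[of "k * x"]
      by (simp add: curv_def acs_def abs_less_iff field_simps)
  next
    case H2xR
    have "1\<^sup>2 < k\<^sup>2" using assms H2xR by (simp add: curv_def)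
    then have k: "1 < k" by (rule power2_less_imp_less[OF _ less_imp_le[OF assms(2)]])
    have "1 \<le> x" using assms H2xR by (auto simp: cs_def cosh_real_ge_1)
    then have "k * 1 \<le> k * x" using assms(2) by (intro mult_left_mono) auto
    then have *: "1 < k * x" using k by linarith
    then have "1 < (k * x)\<^sup>2" by (simp add: one_less_power)
    with * show ?thesis using H2xR arcosh_real_has_field_derivative[of "k * x" UNIV]
      by (simp add: curv_def acs_def)
  qed
  then show "0 < curv X * (1 - (k * x)\<^sup>2)"
    and "(acs X has_real_derivative - curv X / sqrt (curv X * (1 - (k * x)\<^sup>2))) (at (k * x))"
    by auto
qed

text \<open>The factors tend to 1 from the side on which \<open>acs\<close> is smooth. With + 1 in
  place of + 2 the first factor on the sphere would be 0.\<close>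

lemma acs_tendsto:
  assumes "x \<in> range (cs X)"
  shows "(\<lambda>n. acs X ((1 - curv X / (real n + 2)) * x)) \<longlonglongrightarrow> acs X x"
proof -
  have l: "(\<lambda>n. (1 - curv X / (real n + 2)) * x) \<longlonglongrightarrow> (1 - curv X * 0) * x"
    using LIMSEQ_Suc[OF LIMSEQ_inverse_real_of_nat]
    by (intro tendsto_intros) (simp add: divide_inverse add.commute tendsto_mult_right_zero)
  show ?thesis
  proof (cases X)
    case S2xR
    have "\<bar>x\<bar> \<le> 1" using assms S2xR by (auto simp: cs_def)
    then have "\<bar>(1 - 1 / (real n + 2)) * x\<bar> \<le> 1" for n
      unfolding abs_mult by (intro mult_le_one) (auto simp: field_simps)
    then show ?thesis using l \<open>\<bar>x\<bar> \<le> 1\<close> S2xR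
      by (auto simp: acs_def curv_def abs_le_iff
          intro!: continuous_on_tendsto_compose[OF continuous_on_arccos'])
  next
    case H2xR
    have "1 \<le> x" using assms H2xR by (auto simp: cs_def cosh_real_ge_1)
    then have "1 \<le> (1 + 1 / (real n + 2)) * x" for n
      using mult_mono[of 1 "1 + 1 / (real n + 2)" 1 x] by simp
    then show ?thesis using l \<open>1 \<le> x\<close> H2xR
      by (auto simp: acs_def curv_def intro!: tendsto_arcosh_strong)
  qed
qed

section \<open>The distance formula\<close>

lemma mult_add_le_sqrt:
  fixes a b x y :: real
  assumes "a\<^sup>2 + b\<^sup>2 = 1"
  shows "a * x + b * y \<le> sqrt (x\<^sup>2 + y\<^sup>2)"
proof (rule real_le_rsqrt)
  have "(a * x + b * y)\<^sup>2 = (a\<^sup>2 + b\<^sup>2) * (x\<^sup>2 + y\<^sup>2) - (a * y - b * x)\<^sup>2"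
    by (simp add: power2_eq_square algebra_simps)
  with assms show "(a * x + b * y)\<^sup>2 \<le> x\<^sup>2 + y\<^sup>2" by simp
qed

text \<open>For a curve through p with velocity v, the vector paired with u is the velocity of its
  direction m. It is tangent at m, with squared length metric minus the square of \<tau>, and pairs
  only with the tangent part of u at m, of squared length \<open>curv X * (1 - x\<^sup>2)\<close>;
  Cauchy-Schwarz does the rest.\<close>

lemma direction_speed_bound:
  fixes u p v :: "real^3"
  assumes u: "u \<in> unit_points X" and p: "p \<in> points X"
  defines "x \<equiv> form X u (dir X p)" and "\<tau> \<equiv> form X p v / form X p p"
  shows "(form X u (v /\<^sub>R sqrt (form X p p) - \<tau> *\<^sub>R dir X p))\<^sup>2
    \<le> curv X * (1 - x\<^sup>2) * (metric X p v - \<tau>\<^sup>2)"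
    and "0 \<le> metric X p v - \<tau>\<^sup>2"
proof -
  define N where "N = form X p p"
  define m where "m = dir X p"
  define n where "n = v /\<^sub>R sqrt N - \<tau> *\<^sub>R m"
  have N: "0 < N" using points_form_pos[OF p] by (simp add: N_def)
  have m: "m \<in> unit_points X" using dir_unit_points[OF p] by (simp add: m_def)
  then have m1: "form X m m = 1" "m \<in> points X" by (auto simp: unit_points_def)
  have mv: "form X m (v /\<^sub>R sqrt N) = \<tau>"
    unfolding m_def dir_def \<tau>_def N_def[symmetric]
    using N by (simp add: form_bilinear_simps flip: power2_eq_square) (simp add: field_simps)
  have mn: "form X m n = 0"
    by (simp add: n_def bilinear_rsub[OF bilinear_form] mv) (simp add: form_bilinear_simps m1)
  have vv: "form X (v /\<^sub>R sqrt N) (v /\<^sub>R sqrt N) = form X v v / N"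
    using N by (simp add: form_bilinear_simps divide_inverse power_inverse flip: power2_eq_square mult.assoc)
  have "form X n n = form X v v / N - \<tau>\<^sup>2"
    unfolding n_def bilinear_lsub[OF bilinear_form] bilinear_rsub[OF bilinear_form]
      bilinear_lmul[OF bilinear_form, where x=m] bilinear_rmul[OF bilinear_form, where y=m] vv mv
      form_commute[of X "v /\<^sub>R sqrt N" m] m1
    by (simp add: power2_eq_square)
  then have nn: "curv X * form X n n = metric X p v - \<tau>\<^sup>2"
    using metric_form[of X p v] by (simp add: N_def \<tau>_def)
  then show "0 \<le> metric X p v - \<tau>\<^sup>2"
    using form_orthogonal_nonneg[OF m1(2) mn] by simp
  let ?y = "u - x *\<^sub>R m"
  have y: "form X m ?y = 0" "form X ?y ?y = 1 - x\<^sup>2"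
    using unit_form_diff[of X m u] m1 u by (simp_all add: x_def m_def unit_points_def form_commute)
  have "form X ?y n = form X u n"
    using mn by (simp add: bilinear_lsub[OF bilinear_form] bilinear_lmul[OF bilinear_form])
  then have "(form X u n)\<^sup>2 \<le> (1 - x\<^sup>2) * form X n n"
    using form_orthogonal_Cauchy_Schwarz[OF m1(2) y(1) mn] y by simp
  also have "\<dots> = curv X * (1 - x\<^sup>2) * (metric X p v - \<tau>\<^sup>2)"
    unfolding nn[symmetric] using curv_square(1)[of X] by algebra
  finally show "(form X u (v /\<^sub>R sqrt (form X p p) - \<tau> *\<^sub>R dir X p))\<^sup>2
    \<le> curv X * (1 - x\<^sup>2) * (metric X p v - \<tau>\<^sup>2)"
    by (simp add: n_def N_def m_def)
qed

lemma height_has_real_derivative: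
  assumes c: "(c has_vector_derivative v) (at s within A)" and p: "c s \<in> points X"
  shows "((\<lambda>s. height X (c s)) has_real_derivative form X (c s) v / form X (c s) (c s)) (at s within A)"
  using points_form_pos[OF p] unfolding height_def
  by (auto intro!: derivative_eq_intros c simp: form_commute[of X v] field_simps)

lemma form_dir_has_real_derivative:
  assumes c: "(c has_vector_derivative v) (at s within A)" and p: "c s \<in> points X"
  shows "((\<lambda>s. form X u (dir X (c s))) has_real_derivative
    form X u (v /\<^sub>R sqrt (form X (c s) (c s)) - (form X (c s) v / form X (c s) (c s)) *\<^sub>R dir X (c s)))
    (at s within A)"
proof -
  define N where "N = form X (c s) (c s)"
  have N: "0 < N" using points_form_pos[OF p] by (simp add: N_def)
  have eq: "form X u (dir X p) = form X u p / sqrt (form X p p)" for p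
    by (simp add: dir_def form_bilinear_simps divide_inverse mult.commute)
  have "((\<lambda>s. form X u (c s) / sqrt (form X (c s) (c s))) has_real_derivative
    (form X u v * sqrt N - form X u (c s) * (2 * form X (c s) v / (2 * sqrt N))) / (sqrt N * sqrt N)) (at s within A)"
    using N by (auto intro!: derivative_eq_intros c simp: form_commute[of X v] form_bilinear_simps field_simps simp flip: N_def)
  also have "(form X u v * sqrt N - form X u (c s) * (2 * form X (c s) v / (2 * sqrt N))) / (sqrt N * sqrt N) =
     form X u (v /\<^sub>R sqrt N - (form X (c s) v / N) *\<^sub>R dir X (c s))"
    using N by (simp add: form_bilinear_simps dir_def N_def[symmetric] field_simps)
  finally show ?thesis by (simp add: eq N_def)
qed

lemma continuous_on_metric:
  assumes "continuous_on S c" "continuous_on S d" "c ` S \<subseteq> points X"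
  shows "continuous_on S (\<lambda>s. metric X (c s) (d s))"
proof -
  have *: "metric X (c s) (d s) = (form X (c s) (d s) / form X (c s) (c s))\<^sup>2
    + curv X * (form X (d s) (d s) / form X (c s) (c s) - (form X (c s) (d s) / form X (c s) (c s))\<^sup>2)"
    for s
    by (rule metric_form)
  have "form X (c s) (c s) \<noteq> 0" if "s \<in> S" for s
    using points_form_pos[of "c s" X] assms(3) that by auto
  then show ?thesis
    by (subst *) (auto intro!: continuous_intros assms)
qed

text \<open>
  The distance on the sphere (hyperbolic plane) from a fixed point is not differentiable everywhere.
  Replacing the argument \<open>x\<close> of the inverse function by \<open>k x\<close> makes it smooth, and it stays
  1-Lipschitz.
\<close>

lemma curve_length_lower_bound:
  assumes C1: "c C1_differentiable_on {0..1}" and pts: "c ` {0..1} \<subseteq> points X"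
    and ab: "0 \<le> a" "a\<^sup>2 + b\<^sup>2 = 1"
  shows "a * unit_dist X (dir X (c 0)) (dir X (c 1)) + b * (height X (c 1) - height X (c 0))
    \<le> curve_length X c 0 1"
proof -
  obtain v where v: "\<And>s. s \<in> {0..1} \<Longrightarrow> (c has_vector_derivative v s) (at s)" "continuous_on {0..1} v"
    using C1 unfolding C1_differentiable_on_def by blast
  have cc: "continuous_on {0..1} c"
    using v(1) by (meson continuous_at_imp_continuous_on has_vector_derivative_continuous)
  have p: "c s \<in> points X" if "s \<in> {0..1}" for s using pts that by blast
  define u where "u = dir X (c 0)"
  have u: "u \<in> unit_points X" using dir_unit_points p by (simp add: u_def)
  define x where "x s = form X u (dir X (c s))" for s
  have xr: "x s \<in> range (cs X)" if "s \<in> {0..1}" for s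
    unfolding x_def by (intro unit_points_form_range u dir_unit_points p that)
  have x0: "x 0 = 1" using u by (simp add: x_def u_def[symmetric] unit_points_def)
  let ?speed = "\<lambda>s. sqrt (metric X (c s) (v s))"
  have int: "(?speed has_integral curve_length X c 0 1) {0..1}"
  proof -
    have "continuous_on {0..1} ?speed"
      by (intro continuous_on_real_sqrt continuous_on_metric cc v pts)
    then have "?speed integrable_on {0..1}" by (rule integrable_continuous_real)
    moreover have "curve_length X c 0 1 = integral {0..1} ?speed"
      unfolding curve_length_def
      by (intro integral_cong) (simp add: vector_derivative_at[OF v(1)])
    ultimately show ?thesis by (simp add: has_integral_iff)
  qed
  \<comment> \<open>A calibration: for a unit vector (a, b) the function \<open>f\<close> below
    grows along the curve by at most its length. The pair stays free so that it can later be aimed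
    at the end point.\<close>
  have bound: "a * (acs X (k * x 1) - acs X (k * x 0)) + b * (height X (c 1) - height X (c 0))
      \<le> curve_length X c 0 1" if k: "0 < k" "0 < curv X * (1 - k\<^sup>2)" for k
  proof -
    define \<tau> where "\<tau> s = form X (c s) (v s) / form X (c s) (c s)" for s
    define x' where "x' s = form X u (v s /\<^sub>R sqrt (form X (c s) (c s)) - \<tau> s *\<^sub>R dir X (c s))" for s
    define e where "e s = curv X * (1 - (k * x s)\<^sup>2)" for s
    define f where "f s = a * acs X (k * x s) + b * height X (c s)" for s
    define A where "A s = - curv X / sqrt (e s) * (k * x' s)" for s
    have "((\<lambda>s. a * A s + b * \<tau> s) has_integral (f 1 - f 0)) {0..1}"
    proof (rule fundamental_theorem_of_calculus)
      fix s :: real assume s: "s \<in> {0..1}"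
      have "(x has_real_derivative x' s) (at s within {0..1})"
        unfolding x_def[abs_def] x'_def \<tau>_def
        by (rule form_dir_has_real_derivative[OF has_vector_derivative_at_within[OF v(1)[OF s]] p[OF s]])
      then have "((\<lambda>s. k * x s) has_real_derivative k * x' s) (at s within {0..1})"
        by (rule DERIV_cmult)
      then have "((\<lambda>s. acs X (k * x s)) has_real_derivative A s) (at s within {0..1})"
        unfolding A_def e_def
        by (rule DERIV_chain2[where g = "\<lambda>s. k * x s", OF acs_has_real_derivative(2)[OF xr[OF s] k]])
      moreover have "((\<lambda>s. height X (c s)) has_real_derivative \<tau> s) (at s within {0..1})"
        unfolding \<tau>_def by (rule height_has_real_derivative[OF has_vector_derivative_at_within[OF v(1)[OF s]] p[OF s]])
      ultimately show "(f has_vector_derivative a * A s + b * \<tau> s) (at s within {0..1})"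
        unfolding f_def[abs_def] has_real_derivative_iff_has_vector_derivative[symmetric]
        by (intro DERIV_add DERIV_cmult)
    qed simp
    moreover have "a * A s + b * \<tau> s \<le> ?speed s" if s: "s \<in> {0..1}" for s
    proof -
      have e: "0 < e s" unfolding e_def by (rule acs_has_real_derivative(1)[OF xr[OF s] k])
      have m: "0 \<le> metric X (c s) (v s) - (\<tau> s)\<^sup>2"
        using direction_speed_bound(2)[OF u p[OF s]] by (simp add: \<tau>_def)
      have "(x' s)\<^sup>2 \<le> curv X * (1 - (x s)\<^sup>2) * (metric X (c s) (v s) - (\<tau> s)\<^sup>2)"
        using direction_speed_bound(1)[OF u p[OF s]] by (simp add: x'_def x_def \<tau>_def)
      then have "k\<^sup>2 * (x' s)\<^sup>2 \<le> k\<^sup>2 * (curv X * (1 - (x s)\<^sup>2) * (metric X (c s) (v s) - (\<tau> s)\<^sup>2))"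
        by (intro mult_left_mono) auto
      also have "\<dots> = (k\<^sup>2 * (curv X * (1 - (x s)\<^sup>2))) * (metric X (c s) (v s) - (\<tau> s)\<^sup>2)"
        by simp
      also have "\<dots> \<le> e s * (metric X (c s) (v s) - (\<tau> s)\<^sup>2)"
      proof (rule mult_right_mono[OF _ m])
        \<comment> \<open>The condition on k enters with the right sign: this gap is
          positive.\<close>
        have "e s - k\<^sup>2 * (curv X * (1 - (x s)\<^sup>2)) = curv X * (1 - k\<^sup>2)"
          by (simp add: e_def power_mult_distrib algebra_simps)
        with k show "k\<^sup>2 * (curv X * (1 - (x s)\<^sup>2)) \<le> e s" by linarith
      qed
      finally have "k\<^sup>2 * (x' s)\<^sup>2 / e s \<le> metric X (c s) (v s) - (\<tau> s)\<^sup>2"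
        using e by (simp add: field_simps)
      moreover have "(A s)\<^sup>2 = k\<^sup>2 * (x' s)\<^sup>2 / e s"
        using e by (simp add: A_def power_mult_distrib power_divide)
      ultimately have "sqrt ((A s)\<^sup>2 + (\<tau> s)\<^sup>2) \<le> ?speed s" by simp
      then show ?thesis using mult_add_le_sqrt[OF ab(2)] order_trans by blast
    qed
    ultimately have "f 1 - f 0 \<le> curve_length X c 0 1"
      using has_integral_le[OF _ int] by blast
    then show ?thesis by (simp add: f_def algebra_simps)
  qed
  define \<kappa> where "\<kappa> n = 1 - curv X / (real n + 2)" for n
  have "(\<lambda>n. a * (acs X (\<kappa> n * x 1) - acs X (\<kappa> n * x 0)) + b * (height X (c 1) - height X (c 0)))
    \<longlonglongrightarrow> a * (acs X (x 1) - acs X (x 0)) + b * (height X (c 1) - height X (c 0))"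
    unfolding \<kappa>_def by (intro tendsto_intros acs_tendsto xr) auto
  then have "a * (acs X (x 1) - acs X (x 0)) + b * (height X (c 1) - height X (c 0)) \<le> curve_length X c 0 1"
  proof (rule LIMSEQ_le_const2, intro exI allI impI bound)
    fix n :: nat
    have "0 < 1 - (1 - 1 / (real n + 2))\<^sup>2" "(1 + 1 / (real n + 2))\<^sup>2 > 1"
      by (simp_all add: field_simps power2_eq_square add_pos_nonneg)
    then show "0 < \<kappa> n" "0 < curv X * (1 - (\<kappa> n)\<^sup>2)"
      using curv_cases[of X] by (auto simp: \<kappa>_def field_simps)
  qed
  then show ?thesis unfolding x0 by (simp add: unit_dist_def x_def u_def)
qed

text \<open>The infimum is attained by a screw of constant speed. For the lower bound the
  calibration is taken with (a, b) = (\<theta>, \<tau>) / D, the direction of the hypotenuse, which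
  gives exactly D.\<close>

theorem gdist_eq:
  assumes P: "P \<in> points X" and Q: "Q \<in> points X"
  shows "gdist X P Q = sqrt ((unit_dist X (dir X P) (dir X Q))\<^sup>2 + (height X Q - height X P)\<^sup>2)"
    (is "_ = ?D")
proof -
  let ?\<theta> = "unit_dist X (dir X P) (dir X Q)" and ?\<tau> = "height X Q - height X P"
  let ?S = "{curve_length X c 0 1 | c.
     c C1_differentiable_on {0..1} \<and> c ` {0..1} \<subseteq> points X \<and> c 0 = P \<and> c 1 = Q}"
  obtain w where w: "frame X (dir X P) w" "dir X Q = rot X (dir X P) w ?\<theta>"
    using rot_connect dir_unit_points P Q by blast
  let ?c = "screw X (dir X P) w ?\<theta> ?\<tau> (height X P)"
  have "?c 0 = P" "?c 1 = Q"
    using points_eq_height_dir[OF P] points_eq_height_dir[OF Q] w(2) by (simp_all add: screw_def)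
  then have mem: "?D \<in> ?S"
    using screw_C1 screw_points(1)[OF w(1)] curve_length_screw[OF w(1), of 0 1 ?\<theta> ?\<tau> "height X P"]
    by (intro CollectI exI[of _ ?c]) auto
  have low: "?D \<le> L" if L: "L \<in> ?S" for L
  proof -
    obtain c where c: "L = curve_length X c 0 1" "c C1_differentiable_on {0..1}" "c ` {0..1} \<subseteq> points X"
      "c 0 = P" "c 1 = Q" using L by (elim CollectE exE conjE) (rule that)
    note b = curve_length_lower_bound[OF c(2,3), unfolded c(4,5), folded c(1)]
    show ?thesis
    proof (cases "?D = 0")
      case True
      then have "?\<theta> = 0" "?\<tau> = 0" by (auto simp: sum_power2_eq_zero_iff)
      then show ?thesis using b[of 1 0] by simp
    next
      case False
      define D where "D = ?D"
      have D: "0 < D" using False by (simp add: D_def less_le)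
      have sq: "?\<theta>\<^sup>2 + ?\<tau>\<^sup>2 = D\<^sup>2" by (simp add: D_def)
      have "(?\<theta> / D)\<^sup>2 + (?\<tau> / D)\<^sup>2 = 1"
        unfolding power_divide add_divide_distrib[symmetric] sq using D by simp
      moreover have "0 \<le> ?\<theta> / D"
        using D unit_dist_nonneg dir_unit_points P Q by simp
      ultimately have "?\<theta> / D * ?\<theta> + ?\<tau> / D * ?\<tau> \<le> L" by (intro b)
      also have "?\<theta> / D * ?\<theta> + ?\<tau> / D * ?\<tau> = (?\<theta>\<^sup>2 + ?\<tau>\<^sup>2) / D"
        by (simp add: power2_eq_square add_divide_distrib)
      also have "\<dots> = D" unfolding sq using D by (simp add: power2_eq_square)
      finally show ?thesis by (simp add: D_def)
    qed
  qed
  show ?thesis unfolding gdist_def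
    by (rule cInf_eq_minimum[OF mem low])
qed

lemma gdist_commute: "P \<in> points X \<Longrightarrow> Q \<in> points X \<Longrightarrow> gdist X P Q = gdist X Q P"
  by (simp add: gdist_eq unit_dist_commute power2_commute)

lemma gdist_nonneg: "P \<in> points X \<Longrightarrow> Q \<in> points X \<Longrightarrow> 0 \<le> gdist X P Q"
  by (simp add: gdist_eq)

lemma gdist_eq_0:
  assumes P: "P \<in> points X" and Q: "Q \<in> points X"
  shows "gdist X P Q = 0 \<longleftrightarrow> P = Q"
proof
  assume "gdist X P Q = 0"
  then have "dir X P = dir X Q" "height X P = height X Q"
    using assms by (auto simp: gdist_eq sum_power2_eq_zero_iff unit_dist_eq_0 dir_unit_points)
  then show "P = Q" using points_eq_height_dir[OF P] points_eq_height_dir[OF Q] by metis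
qed (use assms in \<open>simp add: gdist_eq unit_dist_eq_0 dir_unit_points\<close>)

lemma gdist_screw:
  assumes "frame X u w" "\<omega>\<^sup>2 + \<tau>\<^sup>2 = 1" "short X (\<omega> * (a - b))"
  shows "gdist X (screw X u w \<omega> \<tau> t a) (screw X u w \<omega> \<tau> t b) = \<bar>a - b\<bar>"
proof -
  have "gdist X (screw X u w \<omega> \<tau> t a) (screw X u w \<omega> \<tau> t b)
    = sqrt ((\<omega> * a - \<omega> * b)\<^sup>2 + (\<tau> * b - \<tau> * a)\<^sup>2)"
    using assms by (simp add: gdist_eq screw_points unit_dist_rot right_diff_distrib)
  also have "(\<omega> * a - \<omega> * b)\<^sup>2 + (\<tau> * b - \<tau> * a)\<^sup>2 = (\<omega>\<^sup>2 + \<tau>\<^sup>2) * (a - b)\<^sup>2"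
    by (simp add: power2_eq_square algebra_simps)
  finally show ?thesis using assms(2) by simp
qed

section \<open>Classification of the geodesics\<close>

text \<open>The parameters near which c agrees with one fixed member of the family form an open set,
  closed by rigidity, hence the whole line. This turns the local definition of a geodesic into
  global formulas.\<close>

lemma local_to_global:
  fixes c :: "real \<Rightarrow> 'a"
  assumes loc: "\<And>s. \<exists>e>0. \<exists>F\<in>\<F>. \<forall>x. \<bar>x - s\<bar> < e \<longrightarrow> c x = F x"
    and rigid: "\<And>F G a b. F \<in> \<F> \<Longrightarrow> G \<in> \<F> \<Longrightarrow> a < b \<Longrightarrow> \<forall>x\<in>{a<..<b}. F x = G x \<Longrightarrow> F = G"
  shows "c \<in> \<F>"
proof -
  obtain e0 F0 where F0: "e0 > 0" "F0 \<in> \<F>" "\<And>x. \<bar>x - 0\<bar> < e0 \<Longrightarrow> c x = F0 x"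
    using loc[of 0] by blast
  define S where "S = {s. \<exists>e>0. \<forall>x. \<bar>x - s\<bar> < e \<longrightarrow> c x = F0 x}"
  have "open S"
    unfolding open_dist
  proof (intro ballI)
    fix s assume "s \<in> S"
    then obtain e where e: "e > 0" "\<And>x. \<bar>x - s\<bar> < e \<Longrightarrow> c x = F0 x" by (auto simp: S_def)
    have "y \<in> S" if "dist y s < e / 2" for y
      unfolding S_def
    proof (intro CollectI exI[of _ "e / 2"] conjI allI impI)
      fix x assume "\<bar>x - y\<bar> < e / 2"
      with that have "\<bar>x - s\<bar> < e" unfolding dist_real_def by linarith
      then show "c x = F0 x" by (rule e(2))
    qed (use e in simp)
    with e(1) show "\<exists>e>0. \<forall>y. dist y s < e \<longrightarrow> y \<in> S" by (intro exI[of _ "e / 2"]) auto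
  qed
  moreover have "closed S"
    unfolding closed_def open_dist
  proof (intro ballI)
    fix s assume s: "s \<in> - S"
    obtain e F where e: "e > 0" "F \<in> \<F>" "\<And>x. \<bar>x - s\<bar> < e \<Longrightarrow> c x = F x"
      using loc[of s] by blast
    have "y \<notin> S" if y: "dist y s < e" for y
    proof
      assume "y \<in> S"
      then obtain d where d: "d > 0" "\<And>x. \<bar>x - y\<bar> < d \<Longrightarrow> c x = F0 x" by (auto simp: S_def)
      have "\<forall>x\<in>{max (y - d) (s - e)<..<min (y + d) (s + e)}. F x = F0 x"
      proof
        fix x assume "x \<in> {max (y - d) (s - e)<..<min (y + d) (s + e)}"
        then have "\<bar>x - y\<bar> < d" "\<bar>x - s\<bar> < e" by auto
        then show "F x = F0 x" using d(2) e(3) by metis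
      qed
      moreover have "max (y - d) (s - e) < min (y + d) (s + e)"
        using y d(1) e(1) by (auto simp: dist_real_def)
      ultimately have "F = F0" using rigid e(2) F0(2) by blast
      then have "s \<in> S" using e by (auto simp: S_def)
      with s show False by simp
    qed
    with e(1) show "\<exists>e>0. \<forall>y. dist y s < e \<longrightarrow> y \<in> - S" by auto
  qed
  moreover have "0 \<in> S" using F0 by (auto simp: S_def)
  ultimately have S: "S = UNIV" using clopen[of S] by blast
  have "c x = F0 x" for x
  proof -
    have "x \<in> S" using S by simp
    then obtain e where "e > 0" "\<forall>y. \<bar>y - x\<bar> < e \<longrightarrow> c y = F0 y" by (auto simp: S_def)
    then show ?thesis by simp
  qed
  then have "c = F0" by auto
  with F0 show ?thesis by simp
qed

text \<open>The equality case of Minkowski's inequality for (x1, y1) and (x2, y2). That z may be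
  smaller than x1 + x2 does no harm: the two cross differences still have a sum of squares at most
  0.\<close>

lemma sqrt_add_square_proportional:
  fixes x1 x2 y1 y2 r1 r2 z :: real
  assumes "0 \<le> z" "z \<le> x1 + x2" "0 \<le> r1" "0 \<le> r2"
    and r1: "x1\<^sup>2 + y1\<^sup>2 = r1\<^sup>2" and r2: "x2\<^sup>2 + y2\<^sup>2 = r2\<^sup>2"
    and z: "z\<^sup>2 + (y1 + y2)\<^sup>2 = (r1 + r2)\<^sup>2"
  shows "r1 * y2 = r2 * y1"
proof -
  have "z\<^sup>2 \<le> (x1 + x2)\<^sup>2" using assms by (intro power_mono)
  then have 1: "x1 * x2 + y1 * y2 \<ge> r1 * r2"
    using z r1 r2 by (simp add: power2_eq_square algebra_simps)
  have "(r1 * x2 - r2 * x1)\<^sup>2 + (r1 * y2 - r2 * y1)\<^sup>2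
    = r1\<^sup>2 * (x2\<^sup>2 + y2\<^sup>2) + r2\<^sup>2 * (x1\<^sup>2 + y1\<^sup>2) - 2 * (r1 * r2) * (x1 * x2 + y1 * y2)"
    by (simp add: power2_eq_square algebra_simps)
  also have "\<dots> = 2 * (r1 * r2) * (r1 * r2 - (x1 * x2 + y1 * y2))"
    unfolding r1 r2 by (simp add: power2_eq_square algebra_simps)
  also have "\<dots> \<le> 0"
    using 1 assms by (intro mult_nonneg_nonpos) auto
  finally have "(r1 * y2 - r2 * y1)\<^sup>2 \<le> 0"
    using zero_le_power2[of "r1 * x2 - r2 * x1"] by linarith
  then show ?thesis by simp
qed

lemma gdist_square:
  "P \<in> points X \<Longrightarrow> Q \<in> points X \<Longrightarrow>
    (gdist X P Q)\<^sup>2 = (unit_dist X (dir X P) (dir X Q))\<^sup>2 + (height X Q - height X P)\<^sup>2"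
  by (simp add: gdist_eq)

lemma gdist_add_height_proportional:
  assumes "P \<in> points X" "M \<in> points X" "Q \<in> points X"
    and "gdist X P M + gdist X M Q = gdist X P Q"
  shows "gdist X P M * (height X Q - height X M) = gdist X M Q * (height X M - height X P)"
proof (rule sqrt_add_square_proportional)
  show "(unit_dist X (dir X P) (dir X Q))\<^sup>2 + (height X M - height X P + (height X Q - height X M))\<^sup>2
    = (gdist X P M + gdist X M Q)\<^sup>2"
    using assms by (simp add: gdist_square)
qed (use assms in \<open>simp_all add: gdist_square gdist_nonneg unit_dist_nonneg unit_dist_triangle dir_unit_points\<close>)

text \<open>On a minimal arc the equality case makes the height grow in proportion to arc length, so
  it is affine near every parameter; an affine function is determined by two of its values.\<close>

lemma geodesic_height:
  assumes "geodesic X c"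
  shows "\<exists>t \<tau>. \<forall>s. height X (c s) = t + \<tau> * s"
proof -
  have "(\<lambda>s. height X (c s)) \<in> {(\<lambda>s. t + \<tau> * s) | t \<tau>. True}"
  proof (rule local_to_global)
    fix s0
    obtain e where e: "e > 0"
      "\<And>a b. a \<in> {s0-e..s0+e} \<Longrightarrow> b \<in> {s0-e..s0+e} \<Longrightarrow> gdist X (c a) (c b) = \<bar>a - b\<bar>"
      using assms unfolding geodesic_def by meson
    have pts: "c s \<in> points X" for s using assms by (auto simp: geodesic_def)
    define h where "h s = height X (c s)" for s
    define \<tau> where "\<tau> = (h (s0 + e) - h (s0 - e)) / (2 * e)"
    have "h s = (h (s0 - e) - \<tau> * (s0 - e)) + \<tau> * s" if s: "\<bar>s - s0\<bar> < e" for s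
    proof -
      have d: "gdist X (c (s0 - e)) (c s) = s - (s0 - e)" "gdist X (c s) (c (s0 + e)) = s0 + e - s"
        "gdist X (c (s0 - e)) (c (s0 + e)) = 2 * e"
        using e(1) s e(2)[of "s0 - e" s] e(2)[of s "s0 + e"] e(2)[of "s0 - e" "s0 + e"] by (auto simp: abs_if split: if_splits)
      have "(s - (s0 - e)) * (h (s0 + e) - h s) = (s0 + e - s) * (h s - h (s0 - e))"
        using gdist_add_height_proportional[OF pts pts pts, of "s0 - e" s "s0 + e"]
        by (simp add: d h_def)
      then have "2 * e * (h s - h (s0 - e)) = (h (s0 + e) - h (s0 - e)) * (s - (s0 - e))"
        by (simp add: algebra_simps)
      then have "h s - h (s0 - e) = \<tau> * (s - (s0 - e))"
        using e(1) by (simp add: \<tau>_def field_simps)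
      then show ?thesis by (simp add: algebra_simps)
    qed
    then show "\<exists>e>0. \<exists>F\<in>{(\<lambda>s. t + \<tau> * s) | t \<tau>. True}. \<forall>x. \<bar>x - s0\<bar> < e \<longrightarrow> height X (c x) = F x"
      using e(1) unfolding h_def by (intro exI[of _ e] conjI bexI) auto
  next
    fix F G :: "real \<Rightarrow> real" and a b :: real
    assume F: "F \<in> {(\<lambda>s. t + \<tau> * s) | t \<tau>. True}" and G: "G \<in> {(\<lambda>s. t + \<tau> * s) | t \<tau>. True}"
      and ab: "a < b" "\<forall>x\<in>{a<..<b}. F x = G x"
    obtain t \<tau> where F: "F = (\<lambda>s. t + \<tau> * s)" using F by blast
    obtain t' \<tau>' where G: "G = (\<lambda>s. t' + \<tau>' * s)" using G by blast
    let ?x = "(a + b) / 2" and ?y = "(a + 3 * b) / 4"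
    have "F ?x = G ?x" "F ?y = G ?y" using ab by auto
    then have 1: "t + \<tau> * ?x = t' + \<tau>' * ?x" "t + \<tau> * ?y = t' + \<tau>' * ?y" by (simp_all add: F G)
    then have "(\<tau> - \<tau>') * (?y - ?x) = 0" unfolding left_diff_distrib right_diff_distrib by linarith
    moreover have "?y - ?x \<noteq> 0" using ab by simp
    ultimately have "\<tau> = \<tau>'" by simp
    with 1 show "F = G" by (simp add: F G)
  qed
  then obtain t \<tau> where "(\<lambda>s. height X (c s)) = (\<lambda>s. t + \<tau> * s)" by blast
  then show ?thesis by meson
qed


text \<open>Spherical linear interpolation and its hyperbolic analogue. The difference of the two
  sides is orthogonal to m, m0 and m1, hence to itself; on the complement of m the form is definite,
  so the difference vanishes.\<close>

lemma unit_points_three_term: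
  assumes m: "m \<in> unit_points X" and m0: "m0 \<in> unit_points X" and m1: "m1 \<in> unit_points X"
    and "form X m m0 = cs X h" "form X m1 m = cs X (d - h)" "form X m1 m0 = cs X d"
  shows "sn X d *\<^sub>R m = sn X (d - h) *\<^sub>R m0 + sn X h *\<^sub>R m1"
proof -
  let ?y = "sn X d *\<^sub>R m - sn X (d - h) *\<^sub>R m0 - sn X h *\<^sub>R m1"
  have f: "form X m m = 1" "form X m0 m0 = 1" "form X m1 m1 = 1" "form X m m0 = cs X h"
    "form X m0 m = cs X h" "form X m1 m = cs X (d - h)" "form X m m1 = cs X (d - h)"
    "form X m1 m0 = cs X d" "form X m0 m1 = cs X d"
    using assms form_commute by (auto simp: unit_points_def)
  have id: "sn X d = sn X ((d - h) + h)" "cs X d = cs X ((d - h) + h)" by simp_all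
  note cs2 = cs_sn_square[of X "d - h"] cs_sn_square[of X h]
  have 0: "form X ?y m = 0"
    unfolding form_bilinear_simps f id sn_add by (simp add: algebra_simps)
  have 1: "form X ?y m0 = 0"
    unfolding form_bilinear_simps f id sn_add cs_add real_scaleR_def using cs2 by algebra
  have 2: "form X ?y m1 = 0"
    unfolding form_bilinear_simps f id sn_add cs_add real_scaleR_def using cs2 by algebra
  have "form X ?y ?y = 0"
    unfolding bilinear_rsub[OF bilinear_form, of X ?y] bilinear_rmul[OF bilinear_form, of X ?y]
    by (simp add: 0 1 2)
  moreover have "form X m ?y = 0" using 0 form_commute by metis
  ultimately have "?y = 0"
    using form_orthogonal_eq_0[of m X] m unfolding unit_points_def by blast
  then show ?thesis by (simp add: algebra_simps)
qed

text \<open>With the height known, Pythagoras leaves the angular speed sqrt (1 - \<tau>\<tau>). The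
  even function \<open>cs\<close> absorbs the absolute value, so a - b enters with its sign.\<close>

lemma geodesic_dir_form:
  assumes c: "geodesic X c" and h: "\<And>s. height X (c s) = t + \<tau> * s"
  shows "\<tau>\<^sup>2 \<le> 1"
    and "\<exists>e>0. \<forall>a\<in>{s-e..s+e}. \<forall>b\<in>{s-e..s+e}.
      form X (dir X (c a)) (dir X (c b)) = cs X (sqrt (1 - \<tau>\<^sup>2) * (a - b))"
proof -
  have pts: "c s \<in> points X" for s using c by (auto simp: geodesic_def)
  then have unit: "dir X (c s) \<in> unit_points X" for s by (rule dir_unit_points)
  have *: "(unit_dist X (dir X (c a)) (dir X (c b)))\<^sup>2 = (1 - \<tau>\<^sup>2) * (a - b)\<^sup>2"
    if "gdist X (c a) (c b) = \<bar>a - b\<bar>" for a b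
  proof -
    have "(a - b)\<^sup>2 = (unit_dist X (dir X (c a)) (dir X (c b)))\<^sup>2 + (\<tau> * (b - a))\<^sup>2"
      using gdist_square[OF pts pts, of a b] that by (simp add: h right_diff_distrib)
    then show ?thesis by (simp add: power2_eq_square algebra_simps)
  qed
  have loc: "\<exists>e>0. \<forall>a\<in>{s-e..s+e}. \<forall>b\<in>{s-e..s+e}. gdist X (c a) (c b) = \<bar>a - b\<bar>" for s
    using c by (simp add: geodesic_def)
  show le: "\<tau>\<^sup>2 \<le> 1"
  proof -
    obtain e where e: "e > 0" "\<forall>a\<in>{0-e..0+e}. \<forall>b\<in>{0-e..0+e}. gdist X (c a) (c b) = \<bar>a - b\<bar>"
      using loc[of 0] by blast
    then have "gdist X (c e) (c 0) = \<bar>e - 0\<bar>" by force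
    from *[OF this] have "0 \<le> (1 - \<tau>\<^sup>2) * e\<^sup>2"
      using zero_le_power2[of "unit_dist X (dir X (c e)) (dir X (c 0))"] by simp
    then show ?thesis using e(1) by (simp add: zero_le_mult_iff)
  qed
  obtain e where e: "e > 0" "\<forall>a\<in>{s-e..s+e}. \<forall>b\<in>{s-e..s+e}. gdist X (c a) (c b) = \<bar>a - b\<bar>"
    using loc[of s] by blast
  have "form X (dir X (c a)) (dir X (c b)) = cs X (sqrt (1 - \<tau>\<^sup>2) * (a - b))"
    if "a \<in> {s-e..s+e}" "b \<in> {s-e..s+e}" for a b
  proof -
    have "(unit_dist X (dir X (c a)) (dir X (c b)))\<^sup>2 = (\<bar>sqrt (1 - \<tau>\<^sup>2) * (a - b)\<bar>)\<^sup>2"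
      using *[of a b] e(2) that le by (simp add: power_mult_distrib)
    then have "unit_dist X (dir X (c a)) (dir X (c b)) = \<bar>sqrt (1 - \<tau>\<^sup>2) * (a - b)\<bar>"
      using unit_dist_nonneg[OF unit unit] by (subst (asm) power2_eq_iff_nonneg) simp_all
    then show ?thesis
      using cs_unit_dist[OF unit unit, of a b] by simp
  qed
  then show "\<exists>e>0. \<forall>a\<in>{s-e..s+e}. \<forall>b\<in>{s-e..s+e}.
      form X (dir X (c a)) (dir X (c b)) = cs X (sqrt (1 - \<tau>\<^sup>2) * (a - b))"
    using e(1) by blast
qed

text \<open>Two parameters at distance d determine both vectors: the linear system for
  \<open>?U\<close> and \<open>?V\<close> has determinant
  \<open>sn X (\<omega> * d)\<close>.\<close>

lemma rot_eq_imp_eq: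
  assumes "0 \<le> \<omega>" and ab: "a < b" and eq: "\<And>x. x \<in> {a<..<b} \<Longrightarrow> rot X u w (\<omega> * x) = rot X u' w' (\<omega> * x)"
  shows "rot X u w (\<omega> * s) = rot X u' w' (\<omega> * s)"
proof (cases "\<omega> = 0")
  case True
  then show ?thesis using eq[of "(a + b) / 2"] ab by simp
next
  case False
  with assms have \<omega>: "\<omega> > 0" by simp
  \<comment> \<open>\<open>1 / \<omega>\<close> keeps the angle at most 1, hence below pi; the
    quarter of the length keeps the second parameter inside the interval.\<close>
  define d where "d = min (1 / \<omega>) ((b - a) / 4)"
  have d: "0 < d" "d \<le> 1 / \<omega>" "d \<le> (b - a) / 4"
    unfolding d_def using \<omega> ab by (simp_all only: min.cobounded1 min.cobounded2) simp
  have "\<omega> * d \<le> 1" using mult_left_mono[OF d(2), of \<omega>] \<omega> by simp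
  then have sn: "sn X (\<omega> * d) > 0"
    using \<omega> d pi_gt3 by (intro sn_pos) (auto simp del: pi_gt3)
  define x where "x = \<omega> * ((a + b) / 2)"
  let ?U = "u - u'" and ?V = "w - w'"
  have 1: "cs X x *\<^sub>R ?U + sn X x *\<^sub>R ?V = 0"
    using eq[of "(a + b) / 2"] ab by (simp add: x_def rot_def algebra_simps)
  have "rot X u w (\<omega> * ((a + b) / 2 + d)) = rot X u' w' (\<omega> * ((a + b) / 2 + d))"
  proof (rule eq)
    show "(a + b) / 2 + d \<in> {a<..<b}"
      using d(1,3) ab unfolding greaterThanLessThan_iff by (intro conjI; argo)
  qed
  then have 2: "cs X (x + \<omega> * d) *\<^sub>R ?U + sn X (x + \<omega> * d) *\<^sub>R ?V = 0"
    by (simp add: x_def rot_def algebra_simps)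
  have s: "sn X (x + \<omega> * d) * cs X x - sn X x * cs X (x + \<omega> * d) = sn X (\<omega> * d)"
    using sn_diff[of X "x + \<omega> * d" x] by (simp add: mult.commute)
  have "sn X (\<omega> * d) *\<^sub>R ?U = sn X (x + \<omega> * d) *\<^sub>R (cs X x *\<^sub>R ?U + sn X x *\<^sub>R ?V)
      - sn X x *\<^sub>R (cs X (x + \<omega> * d) *\<^sub>R ?U + sn X (x + \<omega> * d) *\<^sub>R ?V)"
    unfolding s[symmetric] by (simp add: algebra_simps)
  also have "\<dots> = 0" unfolding 1 2 by simp
  finally have U: "u = u'" using sn by simp
  have "sn X (\<omega> * d) *\<^sub>R ?V = cs X x *\<^sub>R (cs X (x + \<omega> * d) *\<^sub>R ?U + sn X (x + \<omega> * d) *\<^sub>R ?V)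
      - cs X (x + \<omega> * d) *\<^sub>R (cs X x *\<^sub>R ?U + sn X x *\<^sub>R ?V)"
    unfolding s[symmetric] by (simp add: algebra_simps)
  also have "\<dots> = 0" unfolding 1 2 by simp
  finally have "w = w'" using sn by simp
  with U show ?thesis by simp
qed

text \<open>Near each parameter m interpolates between two of its values and is therefore a
  rotation; rigidity glues the pieces. That u and w form a frame is obtained separately, since it
  does not follow when \<omega> = 0.\<close>

lemma locally_rot:
  assumes m: "\<And>s. m s \<in> unit_points X" and \<omega>: "0 \<le> \<omega>"
    and loc: "\<And>s. \<exists>e>0. \<forall>a\<in>{s-e..s+e}. \<forall>b\<in>{s-e..s+e}. form X (m a) (m b) = cs X (\<omega> * (a - b))"
  shows "\<exists>u w. \<forall>s. m s = rot X u w (\<omega> * s)"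
proof -
  have "m \<in> {(\<lambda>s. rot X u w (\<omega> * s)) | u w. True}"
  proof (rule local_to_global)
    fix s0
    obtain e where e: "e > 0"
      "\<And>a b. a \<in> {s0-e..s0+e} \<Longrightarrow> b \<in> {s0-e..s0+e} \<Longrightarrow> form X (m a) (m b) = cs X (\<omega> * (a - b))"
      using loc by meson
    have "\<exists>u w. \<forall>s. \<bar>s - s0\<bar> < e \<longrightarrow> m s = rot X u w (\<omega> * s)"
    proof (cases "\<omega> = 0")
      case True
      have "m s = rot X (m s0) 0 (\<omega> * s)" if "\<bar>s - s0\<bar> < e" for s
        using e(2)[of s s0] that e(1) True unit_points_eqI[OF m m, of s s0] by (auto simp: abs_less_iff)
      then show ?thesis by blast
    next
      case False
      with \<omega> have \<omega>: "\<omega> > 0" by simp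
      define d where "d = min (1 / \<omega>) e"
      have d: "0 < d" "d \<le> 1 / \<omega>" "d \<le> e"
        unfolding d_def using \<omega> e(1) by (simp_all only: min.cobounded1 min.cobounded2) simp
      have "\<omega> * d \<le> 1" using mult_left_mono[OF d(2), of \<omega>] \<omega> by simp
      then have sn: "sn X (\<omega> * d) > 0"
        using \<omega> d pi_gt3 by (intro sn_pos) (auto simp del: pi_gt3)
      define p q where "p = \<omega> * (s0 + d)" and "q = \<omega> * s0"
      \<comment> \<open>Cramer's rule for the requirement that the rotation take the values m s0 and
        m (s0 + d) at the angles q and p; the determinant is sn (p - q) = sn (\<omega> d).\<close>
      define u where "u = (sn X p *\<^sub>R m s0 - sn X q *\<^sub>R m (s0 + d)) /\<^sub>R sn X (\<omega> * d)"
      define w where "w = (cs X q *\<^sub>R m (s0 + d) - cs X p *\<^sub>R m s0) /\<^sub>R sn X (\<omega> * d)"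
      have "m s = rot X u w (\<omega> * s)" if s: "\<bar>s - s0\<bar> < e" for s
      proof -
        have "sn X (\<omega> * d) *\<^sub>R m s = sn X (\<omega> * d - \<omega> * (s - s0)) *\<^sub>R m s0 + sn X (\<omega> * (s - s0)) *\<^sub>R m (s0 + d)"
        proof (rule unit_points_three_term[OF m m m])
          have "s \<in> {s0-e..s0+e}" "s0 \<in> {s0-e..s0+e}" "s0 + d \<in> {s0-e..s0+e}"
            using s d e(1) by (auto simp: abs_less_iff)
          from e(2)[OF this(1,2)] e(2)[OF this(3,1)] e(2)[OF this(3,2)]
          show "form X (m s) (m s0) = cs X (\<omega> * (s - s0))"
            "form X (m (s0 + d)) (m s) = cs X (\<omega> * d - \<omega> * (s - s0))"
            "form X (m (s0 + d)) (m s0) = cs X (\<omega> * d)"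
            by (simp_all add: algebra_simps)
        qed
        also have "\<omega> * d - \<omega> * (s - s0) = p - \<omega> * s" by (simp add: p_def algebra_simps)
        also have "\<omega> * (s - s0) = \<omega> * s - q" by (simp add: q_def algebra_simps)
        also have "sn X (p - \<omega> * s) *\<^sub>R m s0 + sn X (\<omega> * s - q) *\<^sub>R m (s0 + d)
          = cs X (\<omega> * s) *\<^sub>R (sn X p *\<^sub>R m s0 - sn X q *\<^sub>R m (s0 + d))
            + sn X (\<omega> * s) *\<^sub>R (cs X q *\<^sub>R m (s0 + d) - cs X p *\<^sub>R m s0)"
          by (simp add: sn_diff algebra_simps)
        also have "\<dots> = sn X (\<omega> * d) *\<^sub>R rot X u w (\<omega> * s)"
          unfolding rot_def scaleR_add_right scaleR_left_commute[of "sn X (\<omega> * d)"]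
          using sn by (simp add: u_def w_def)
        finally show ?thesis using sn by simp
      qed
      then show ?thesis by blast
    qed
    then obtain u w where "\<forall>s. \<bar>s - s0\<bar> < e \<longrightarrow> m s = rot X u w (\<omega> * s)" by blast
    then show "\<exists>e>0. \<exists>F\<in>{(\<lambda>s. rot X u w (\<omega> * s)) | u w. True}. \<forall>x. \<bar>x - s0\<bar> < e \<longrightarrow> m x = F x"
      using e(1) by (intro exI[of _ e] conjI bexI[of _ "\<lambda>s. rot X u w (\<omega> * s)"]) auto
  next
    fix F G and a b :: real
    assume F: "F \<in> {(\<lambda>s. rot X u w (\<omega> * s)) | u w. True}" and G: "G \<in> {(\<lambda>s. rot X u w (\<omega> * s)) | u w. True}"
      and ab: "a < b" "\<forall>x\<in>{a<..<b}. F x = G x"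
    obtain u w where F: "F = (\<lambda>s. rot X u w (\<omega> * s))" using F by blast
    obtain u' w' where G: "G = (\<lambda>s. rot X u' w' (\<omega> * s))" using G by blast
    show "F = G"
      using rot_eq_imp_eq[of \<omega> a b X u w u' w'] ab \<omega> unfolding F G by (auto intro!: ext)
  qed
  then obtain u w where m: "m = (\<lambda>s. rot X u w (\<omega> * s))" by blast
  have "\<forall>s. m s = rot X u w (\<omega> * s)" unfolding m by simp
  then show ?thesis by blast
qed

text \<open>Comparing the normalisation at the angles 1 and -1 isolates the mixed term, which is
  odd. As 1 < pi / 2, neither \<open>sn X 1\<close> nor \<open>cs X 1\<close> vanishes.\<close>

lemma rot_unit_points_imp_frame:
  assumes m: "\<And>s. rot X u w (\<omega> * s) \<in> unit_points X" and "\<omega> > 0"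
  shows "frame X u w"
proof -
  have u: "u \<in> unit_points X" using m[of 0] by simp
  have f: "rot X u w a \<in> unit_points X" for a
    using m[of "a / \<omega>"] \<open>\<omega> > 0\<close> by simp
  have "(cs X a)\<^sup>2 + 2 * (cs X a * sn X a) * form X u w + (sn X a)\<^sup>2 * form X w w = 1" for a
    using f[of a] u unfolding unit_points_def rot_def
    by (simp add: form_bilinear_simps form_commute[of X w u] power2_eq_square algebra_simps)
  from this[of 1] this[of "- 1"]
  have "(cs X 1)\<^sup>2 + 2 * ((cs X 1 * sn X 1) * form X u w) + (sn X 1)\<^sup>2 * form X w w = 1"
    "(cs X 1)\<^sup>2 - 2 * ((cs X 1 * sn X 1) * form X u w) + (sn X 1)\<^sup>2 * form X w w = 1"
    by (simp_all add: mult.assoc)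
  then have 1: "(cs X 1 * sn X 1) * form X u w = 0" "(cs X 1)\<^sup>2 + (sn X 1)\<^sup>2 * form X w w = 1"
    by linarith+
  have s: "sn X 1 > 0" using pi_gt3 by (intro sn_pos) (auto simp del: pi_gt3)
  moreover have "cs X 1 > 0"
    using cos_gt_zero_pi[of 1] pi_gt3 by (cases X) (auto simp: cs_def simp del: pi_gt3)
  ultimately have "form X u w = 0" using 1(1) by simp
  moreover have "(sn X 1)\<^sup>2 * form X w w = (sn X 1)\<^sup>2 * curv X"
    using 1(2) cs_sn_square[of X 1] by algebra
  then have "form X w w = curv X" using s by simp
  ultimately show ?thesis using u by (simp add: frame_def)
qed

theorem geodesic_screw:
  assumes "geodesic X c"
  shows "\<exists>u w \<omega> \<tau> t. frame X u w \<and> 0 \<le> \<omega> \<and> \<omega>\<^sup>2 + \<tau>\<^sup>2 = 1 \<and> (\<forall>s. c s = screw X u w \<omega> \<tau> t s)"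
proof -
  have pts: "c s \<in> points X" for s using assms by (auto simp: geodesic_def)
  then have unit: "dir X (c s) \<in> unit_points X" for s by (rule dir_unit_points)
  obtain t \<tau> where h: "\<And>s. height X (c s) = t + \<tau> * s"
    using geodesic_height[OF assms] by blast
  define \<omega> where "\<omega> = sqrt (1 - \<tau>\<^sup>2)"
  have \<omega>: "0 \<le> \<omega>" "\<omega>\<^sup>2 + \<tau>\<^sup>2 = 1"
    using geodesic_dir_form(1)[OF assms h] by (simp_all add: \<omega>_def)
  obtain u w where uw: "\<And>s. dir X (c s) = rot X u w (\<omega> * s)"
    using locally_rot[where m = "\<lambda>s. dir X (c s)", OF unit \<omega>(1) geodesic_dir_form(2)[OF assms h, folded \<omega>_def]]
    by blast
  \<comment> \<open>For \<omega> = 0 the geodesic is a fibre, and any unit tangent vector may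
    replace w.\<close>
  have "\<exists>w. frame X u w \<and> (\<forall>s. dir X (c s) = rot X u w (\<omega> * s))"
  proof (cases "\<omega> = 0")
    case True
    have "u \<in> unit_points X" using unit[of 0] uw[of 0] by simp
    then obtain w' where "frame X u w'" using frame_exists by blast
    with uw True show ?thesis by auto
  next
    case False
    have "rot X u w (\<omega> * s) \<in> unit_points X" for s
      using unit[of s] by (simp only: uw)
    then have "frame X u w"
      by (rule rot_unit_points_imp_frame) (use False \<omega>(1) in simp)
    with uw show ?thesis by blast
  qed
  then obtain w' where "frame X u w'" "\<And>s. dir X (c s) = rot X u w' (\<omega> * s)" by blast
  moreover from this have "c s = screw X u w' \<omega> \<tau> t s" for s
    using points_eq_height_dir[OF pts, of s] by (simp add: screw_def h)
  ultimately show ?thesis using \<omega> by blast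
qed

text \<open>As B has its distance from A as parameter, Pythagoras makes the angle swept up to B
  equal to the distance of the directions, which is at most pi on the sphere.\<close>

lemma geodesic_through_screw:
  assumes "geodesic_through X A B c"
  shows "\<exists>u w \<omega> \<tau> t. frame X u w \<and> 0 \<le> \<omega> \<and> \<omega>\<^sup>2 + \<tau>\<^sup>2 = 1 \<and> (\<forall>s. c s = screw X u w \<omega> \<tau> t s)
    \<and> short X (\<omega> * gdist X A B)"
proof -
  obtain u w \<omega> \<tau> t where c: "frame X u w" "0 \<le> \<omega>" "\<omega>\<^sup>2 + \<tau>\<^sup>2 = 1" "\<And>s. c s = screw X u w \<omega> \<tau> t s"
    using geodesic_screw assms unfolding geodesic_through_def by blast
  define d where "d = gdist X A B"
  have AB: "A = screw X u w \<omega> \<tau> t 0" "B = screw X u w \<omega> \<tau> t d"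
    using assms c(4) by (auto simp: geodesic_through_def d_def)
  have pts: "A \<in> points X" "B \<in> points X" unfolding AB by (rule screw_points[OF c(1)])+
  have d0: "0 \<le> d" unfolding d_def by (rule gdist_nonneg[OF pts])
  let ?\<theta> = "unit_dist X (dir X A) (dir X B)"
  have "d\<^sup>2 = ?\<theta>\<^sup>2 + (\<tau> * d)\<^sup>2"
    using gdist_square[OF pts] unfolding d_def[symmetric] by (simp add: AB screw_points[OF c(1)])
  then have "?\<theta>\<^sup>2 = (1 - \<tau>\<^sup>2) * d\<^sup>2" by (simp add: power_mult_distrib algebra_simps)
  also have "1 - \<tau>\<^sup>2 = \<omega>\<^sup>2" using c(3) by simp
  finally have "?\<theta>\<^sup>2 = (\<omega> * d)\<^sup>2" by (simp add: power_mult_distrib)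
  then have "?\<theta> = \<omega> * d"
    using unit_dist_nonneg[OF dir_unit_points dir_unit_points, OF pts] c(2) d0
    by (subst (asm) power2_eq_iff_nonneg) auto
  then have "short X (\<omega> * d)"
    using unit_dist_short[OF dir_unit_points dir_unit_points, OF pts] by simp
  with c show ?thesis unfolding d_def by blast
qed

section \<open>The vertices lie in the plane of the triangle\<close>

lemma gdist_triangle:
  assumes "A \<in> points X" "B \<in> points X" "C \<in> points X"
  shows "gdist X A C \<le> gdist X A B + gdist X B C"
proof -
  let ?d = "\<lambda>P Q. unit_dist X (dir X P) (dir X Q)" and ?h = "height X"
  have "?d A C \<le> ?d A B + ?d B C"
    using assms by (intro unit_dist_triangle dir_unit_points)
  then have "(?d A C)\<^sup>2 \<le> (?d A B + ?d B C)\<^sup>2"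
    using assms by (intro power_mono unit_dist_nonneg dir_unit_points)
  then have "gdist X A C \<le> sqrt ((?d A B + ?d B C)\<^sup>2 + ((?h B - ?h A) + (?h C - ?h B))\<^sup>2)"
    using assms by (simp add: gdist_eq)
  also have "\<dots> \<le> gdist X A B + gdist X B C"
    unfolding gdist_eq[OF assms(1,2)] gdist_eq[OF assms(2,3)] by (rule real_sqrt_sum_squares_triangle_ineq)
  finally show ?thesis .
qed

section \<open>Compactness of closed balls\<close>

lemma continuous_on_acs: "continuous_on (range (cs X)) (acs X)"
proof (cases X)
  case S2xR
  have "range cos \<subseteq> {-1..1::real}" by auto
  then show ?thesis using S2xR continuous_on_subset[OF continuous_on_arccos'] by (simp add: acs_def cs_def)
next
  case H2xR
  have "range cosh \<subseteq> {1::real..}" by (auto simp: cosh_real_ge_1)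
  then show ?thesis using H2xR by (auto simp: acs_def cs_def intro: continuous_on_arcosh)
qed

lemma continuous_on_gdist:
  assumes A: "A \<in> points X"
  shows "continuous_on (points X) (\<lambda>x. gdist X x A)"
proof -
  have pos: "form X x x > 0" "form X x x \<noteq> 0" if "x \<in> points X" for x
    using points_form_pos[OF that] by auto
  have "continuous_on (points X) (\<lambda>x. form X (dir X x) (dir X A))"
    unfolding dir_def using pos by (intro continuous_intros) auto
  then have "continuous_on (points X) (\<lambda>x. unit_dist X (dir X x) (dir X A))"
    unfolding unit_dist_def
    by (rule continuous_on_compose2[OF continuous_on_acs])
      (use A in \<open>auto intro!: unit_points_form_range dir_unit_points\<close>)
  moreover have "continuous_on (points X) (height X)"
    unfolding height_def[abs_def] using pos by (intro continuous_intros) auto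
  ultimately have "continuous_on (points X)
      (\<lambda>x. sqrt ((unit_dist X (dir X x) (dir X A))\<^sup>2 + (height X A - height X x)\<^sup>2))"
    by (intro continuous_intros)
  then show ?thesis
    by (rule continuous_on_cong[THEN iffD1, rotated -1]) (simp_all add: gdist_eq A)
qed

lemma cs_le_cosh: "\<bar>\<theta>\<bar> \<le> r \<Longrightarrow> cs X \<theta> \<le> cosh r"
proof (cases X)
  case S2xR
  then show ?thesis using order_trans[OF cos_le_one cosh_real_ge_1, of \<theta> r] by (simp add: cs_def)
next
  case H2xR
  assume "\<bar>\<theta>\<bar> \<le> r"
  then have "cosh \<bar>\<theta>\<bar> \<le> cosh r" by (subst cosh_real_nonneg_le_iff) auto
  then show ?thesis using H2xR by (simp add: cs_def)
qed

text \<open>In the Lorentzian case Cauchy-Schwarz on the last two coordinates gives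
  \<open>(u$1 - k) * x$1 \<le> form X u x\<close> on the closed cone, with k < \<open>u$1\<close>
  because u is interior. So M bounds \<open>x$1\<close>, and the cone bounds the other
  coordinates.\<close>

lemma bounded_form_region:
  assumes u: "u \<in> points X"
  shows "bounded {x. form X x x \<ge> 0 \<and> form X x x \<le> N \<and> form X u x \<le> M \<and> (X = H2xR \<longrightarrow> x$1 \<ge> 0)}"
proof (cases X)
  case S2xR
  show ?thesis
  proof (rule boundedI[of _ "sqrt N"])
    fix x assume "x \<in> {x. form X x x \<ge> 0 \<and> form X x x \<le> N \<and> form X u x \<le> M \<and> (X = H2xR \<longrightarrow> x$1 \<ge> 0)}"
    then show "norm x \<le> sqrt N" using S2xR by (simp add: form_def norm_eq_sqrt_inner)
  qed
next
  case H2xR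
  define k where "k = sqrt ((u$2)\<^sup>2 + (u$3)\<^sup>2)"
  have u1: "u$1 > 0" "(u$2)\<^sup>2 + (u$3)\<^sup>2 < (u$1)\<^sup>2"
    using u H2xR by (auto simp: lorentz_def power2_eq_square)
  have k: "k < u$1" "0 \<le> k"
    using u1 by (auto simp: k_def intro: real_less_lsqrt)
  show ?thesis
  proof (rule boundedI[of _ "sqrt (2 * (M / (u$1 - k))\<^sup>2)"])
    fix x assume "x \<in> {x. form X x x \<ge> 0 \<and> form X x x \<le> N \<and> form X u x \<le> M \<and> (X = H2xR \<longrightarrow> x$1 \<ge> 0)}"
    then have x: "lorentz x x \<ge> 0" "lorentz u x \<le> M" "x$1 \<ge> 0" using H2xR by (auto simp: form_def)
    define y where "y = (x$2)\<^sup>2 + (x$3)\<^sup>2"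
    have y: "y \<le> (x$1)\<^sup>2" using x(1) by (simp add: lorentz_def y_def power2_eq_square)
    have "(u$2 * x$2 + u$3 * x$3)\<^sup>2 \<le> ((u$2)\<^sup>2 + (u$3)\<^sup>2) * y"
      using zero_le_power2[of "u$2 * x$3 - u$3 * x$2"] unfolding y_def
      by (simp add: power2_eq_square algebra_simps)
    also have "\<dots> \<le> (k * x$1)\<^sup>2"
      using y by (simp add: k_def power_mult_distrib mult_left_mono)
    finally have "u$2 * x$2 + u$3 * x$3 \<le> k * x$1"
      by (rule power2_le_imp_le[OF _ mult_nonneg_nonneg[OF k(2) x(3)]])
    then have "(u$1 - k) * x$1 \<le> M" using x(2) by (simp add: lorentz_def algebra_simps)
    then have "x$1 \<le> M / (u$1 - k)" using k by (simp add: field_simps)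
    then have "(x$1)\<^sup>2 \<le> (M / (u$1 - k))\<^sup>2" using x(3) by (intro power_mono)
    moreover have "(norm x)\<^sup>2 = (x$1)\<^sup>2 + y"
      unfolding power2_norm_eq_inner by (simp add: inner_vec_def sum_3 y_def power2_eq_square)
    ultimately have "(norm x)\<^sup>2 \<le> 2 * (M / (u$1 - k))\<^sup>2" using y by linarith
    then show "norm x \<le> sqrt (2 * (M / (u$1 - k))\<^sup>2)" by (rule real_le_rsqrt)
  qed
qed

text \<open>Needed for the minimum demanded in \<open>surface_points\<close>. The ball lies in a
  region \<open>K\<close> given by non-strict, hence closed, conditions; the lower bound on the form
  keeps \<open>K\<close> away from the boundary of the model.\<close>

lemma compact_gdist_ball:
  assumes A: "A \<in> points X"
  shows "compact {x \<in> points X. gdist X x A \<le> r}"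
proof -
  let ?u = "dir X A" and ?h = "height X A"
  have u: "?u \<in> unit_points X" "?u \<in> points X" using dir_unit_points[OF A] by (auto simp: unit_points_def)
  define K where "K = {x. exp (2 * (?h - r)) \<le> form X x x} \<inter> {x. form X x x \<le> exp (2 * (?h + r))}
    \<inter> {x. form X ?u x \<le> exp (?h + r) * cosh r} \<inter> {x. X = H2xR \<longrightarrow> x$1 \<ge> 0}"
  have "continuous_on UNIV (\<lambda>x. form X x x)" "continuous_on UNIV (form X ?u)"
    by (intro continuous_intros)+
  then have "closed K"
    unfolding K_def
    by (cases X) (auto intro!: closed_Int closed_Collect_le continuous_intros)
  moreover have pos: "0 < form X x x" if "x \<in> K" for x
    using that less_le_trans[OF exp_gt_zero, of "2 * (?h - r)" "form X x x"] unfolding K_def by simp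
  then have "K \<subseteq> {x. form X x x \<ge> 0 \<and> form X x x \<le> exp (2 * (?h + r)) \<and> form X ?u x \<le> exp (?h + r) * cosh r
      \<and> (X = H2xR \<longrightarrow> x$1 \<ge> 0)}"
    unfolding K_def by (auto intro: less_imp_le)
  then have "bounded K" using bounded_form_region[OF u(2)] bounded_subset by blast
  ultimately have K: "compact K" by (simp add: compact_eq_bounded_closed)
  have Kp: "K \<subseteq> points X"
  proof
    fix x assume x: "x \<in> K"
    show "x \<in> points X"
    proof (cases X)
      case S2xR
      then show ?thesis using pos[OF x] by (auto simp: form_def)
    next
      case H2xR
      then have l: "lorentz x x > 0" using pos[OF x] by (simp add: form_def)
      then have "(x$2)\<^sup>2 + (x$3)\<^sup>2 < (x$1)\<^sup>2" by (simp add: lorentz_def power2_eq_square)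
      then have "x$1 \<noteq> 0" by (metis zero_power2 not_sum_power2_lt_zero)
      then show ?thesis using H2xR x l by (auto simp: K_def)
    qed
  qed
  have BK: "{x \<in> points X. gdist X x A \<le> r} = {x \<in> K. gdist X x A \<le> r}"
  proof (intro set_eqI iffI)
    fix x assume "x \<in> {x \<in> points X. gdist X x A \<le> r}"
    then have x: "x \<in> points X" "gdist X x A \<le> r" by auto
    have ux: "dir X x \<in> unit_points X" using dir_unit_points x by blast
    have "0 \<le> r" using gdist_nonneg[OF x(1) A] x(2) by linarith
    then have "(gdist X x A)\<^sup>2 \<le> r\<^sup>2" using x gdist_nonneg[OF x(1) A] by (intro power_mono)
    then have "(unit_dist X (dir X x) ?u)\<^sup>2 + (?h - height X x)\<^sup>2 \<le> r\<^sup>2"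
      using gdist_square[OF x(1) A] by simp
    then have "(unit_dist X (dir X x) ?u)\<^sup>2 \<le> r\<^sup>2" "(?h - height X x)\<^sup>2 \<le> r\<^sup>2"
      using zero_le_power2[of "unit_dist X (dir X x) ?u"] zero_le_power2[of "?h - height X x"] by linarith+
    then have *: "\<bar>unit_dist X (dir X x) ?u\<bar> \<le> r" "\<bar>?h - height X x\<bar> \<le> r"
      using \<open>0 \<le> r\<close> by (metis abs_le_square_iff abs_of_nonneg)+
    define t where "t = height X x"
    have t: "?h - r \<le> t" "t \<le> ?h + r" using *(2) by (auto simp: t_def)
    have xe: "x = exp t *\<^sub>R dir X x" using points_eq_height_dir[OF x(1)] by (simp add: t_def)
    have "form X x x = exp t * exp t * form X (dir X x) (dir X x)"
      by (subst xe, subst xe) (simp add: form_bilinear_simps)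
    then have fx: "form X x x = exp (2 * t)"
      using ux unfolding unit_points_def mult_2 exp_add by simp
    have "form X ?u (dir X x) \<le> cosh r"
      using cs_unit_dist[OF ux u(1)] cs_le_cosh[OF *(1), of X] by (simp add: form_commute)
    then have "exp t * form X ?u (dir X x) \<le> exp (?h + r) * cosh r"
      using t u(1) by (intro order_trans[OF mult_left_mono mult_right_mono]) auto
    then have "form X ?u x \<le> exp (?h + r) * cosh r"
      by (subst xe) (simp add: form_bilinear_simps)
    then show "x \<in> {x \<in> K. gdist X x A \<le> r}"
      using x t by (auto simp: K_def fx)
  next
    fix x assume "x \<in> {x \<in> K. gdist X x A \<le> r}"
    then show "x \<in> {x \<in> points X. gdist X x A \<le> r}" using Kp by auto
  qed
  have "closed {x \<in> K. gdist X x A \<le> r}"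
    by (intro continuous_on_closed_Collect_le continuous_on_subset[OF continuous_on_gdist[OF A] Kp]
        continuous_on_const compact_imp_closed K)
  then have "compact (K \<inter> {x \<in> K. gdist X x A \<le> r})" by (intro compact_Int_closed K)
  moreover have "K \<inter> {x \<in> K. gdist X x A \<le> r} = {x \<in> K. gdist X x A \<le> r}" by auto
  ultimately show ?thesis unfolding BK by simp
qed

lemma geodesic_through_gdist:
  assumes "geodesic_through X A B c" "0 \<le> s" "s \<le> gdist X A B"
  shows "gdist X A (c s) = s" "gdist X (c s) B = gdist X A B - s"
proof -
  obtain u w \<omega> \<tau> t where c: "frame X u w" "0 \<le> \<omega>" "\<omega>\<^sup>2 + \<tau>\<^sup>2 = 1" "\<And>s. c s = screw X u w \<omega> \<tau> t s"
    "short X (\<omega> * gdist X A B)"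
    using geodesic_through_screw[OF assms(1)] by blast
  have AB: "A = c 0" "B = c (gdist X A B)" using assms(1) by (auto simp: geodesic_through_def)
  have sh: "short X (\<omega> * x)" if "\<bar>x\<bar> \<le> gdist X A B" for x
  proof -
    have "\<bar>\<omega> * x\<bar> \<le> \<bar>\<omega> * gdist X A B\<bar>"
      using that c(2) by (simp add: abs_mult mult_left_mono)
    then show ?thesis using c(5) by (auto simp: short_def)
  qed
  have "gdist X (c 0) (c s) = \<bar>0 - s\<bar>"
    unfolding c(4) using assms by (intro gdist_screw c sh) auto
  then show "gdist X A (c s) = s" using AB assms(2) by simp
  have "gdist X (c s) (c (gdist X A B)) = \<bar>s - gdist X A B\<bar>"
    unfolding c(4) using assms by (intro gdist_screw c sh) auto
  then show "gdist X (c s) B = gdist X A B - s" using AB assms(3) by simp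
qed

text \<open>A large first ratio n forces points towards \<open>A1\<close>. The second ratio is read
  off from the point P of the side, so that the Apollonius curve is nonempty; compactness then
  yields a point of it nearest to \<open>A0\<close>. This point may differ from P, but the triangle
  inequality puts the whole curve within d / (n - 1) of \<open>A1\<close>.\<close>

lemma surface_point_near_vertex:
  assumes A: "A0 \<in> points X" "A1 \<in> points X" "A2 \<in> points X"
    and c: "geodesic_through X A0 A1 c" and ne: "A0 \<noteq> A1" and n: "1 < (n::real)"
  shows "\<exists>x \<in> triangle_surface X A0 A1 A2 \<inter> points X. gdist X x A1 \<le> gdist X A0 A1 / (n - 1)"
proof -
  define d where "d = gdist X A0 A1"
  have d: "0 < d" using gdist_nonneg[OF A(1,2)] gdist_eq_0[OF A(1,2)] ne by (simp add: d_def less_le)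
  \<comment> \<open>P divides the side in the ratio n : 1.\<close>
  define s where "s = d * n / (n + 1)"
  define P where "P = c s"
  have s: "0 < s" "s \<le> d" "s = n * (d - s)" "d - s \<le> d / (n - 1)"
    using d n by (simp_all add: s_def field_simps)
  have PA: "gdist X A0 P = s" "gdist X P A1 = d - s"
    using geodesic_through_gdist[OF c, of s] s unfolding P_def d_def by auto
  have P: "P \<in> points X" using c by (auto simp: geodesic_through_def geodesic_def P_def)
  show ?thesis
  proof (cases "P = A2")
    \<comment> \<open>The second ratio would be 0 here, where the curve is {\<open>A2\<close>} by
      definition; so P is a surface point anyway.\<close>
    case True
    have "A2 \<in> surface_points X A0 A1 A2 1 0" by (simp add: surface_points_def apollonius_curve_def)
    then have "A2 \<in> triangle_surface X A0 A1 A2"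
      unfolding triangle_surface_def
      by (intro UnionI[of "surface_points X A0 A1 A2 1 0"] CollectI exI[of _ "1::real"] exI[of _ "0::real"]) auto
    then show ?thesis using True P PA(2) s(4) unfolding d_def[symmetric] by (intro bexI[of _ P]) auto
  next
    case False
    define l2 where "l2 = gdist X A2 P / gdist X P A0"
    have PA0: "gdist X P A0 = s" using PA(1) gdist_commute[OF A(1) P] by simp
    have "gdist X A2 P > 0" using False gdist_nonneg[OF A(3) P] gdist_eq_0[OF A(3) P] by (simp add: less_le)
    then have l2: "l2 > 0" using s by (simp add: l2_def PA0)
    define C where "C = apollonius_curve X A0 A1 A2 n l2"
    have C_eq: "C = {x \<in> points X. gdist X A0 x = n * gdist X x A1 \<and> gdist X A2 x = l2 * gdist X x A0}"
      using n l2 by (auto simp: C_def apollonius_curve_def apollonius_surface_def)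
    have PC: "P \<in> C" using P PA s l2 by (simp add: C_eq l2_def PA0)
    have near: "gdist X x A1 \<le> d / (n - 1)" if "x \<in> C" for x
    proof -
      have x: "x \<in> points X" "gdist X A0 x = n * gdist X x A1" using that by (auto simp: C_eq)
      have "n * gdist X x A1 \<le> d + gdist X x A1"
        using gdist_triangle[OF A(1,2) x(1)] x gdist_commute[OF A(2) x(1)] by (simp add: d_def)
      then show ?thesis using n by (simp add: field_simps)
    qed
    define B where "B = {x \<in> points X. gdist X x A1 \<le> d / (n - 1)}"
    have B: "compact B" unfolding B_def by (rule compact_gdist_ball[OF A(2)])
    have cont: "continuous_on B (\<lambda>x. gdist X x A)" if "A \<in> points X" for A
      using continuous_on_gdist[OF that] by (rule continuous_on_subset) (auto simp: B_def)
    have C_Int: "C = B \<inter> {x \<in> B. gdist X x A0 = n * gdist X x A1} \<inter> {x \<in> B. gdist X x A2 = l2 * gdist X x A0}"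
      using near gdist_commute A by (auto simp: C_eq B_def)
    have clo: "closed {x \<in> B. f x = g x}" if "continuous_on B f" "continuous_on B g" for f g :: "real^3 \<Rightarrow> real"
      using continuous_closed_preimage_constant[OF continuous_on_diff[OF that] compact_imp_closed[OF B], of 0]
      by simp
    have "closed {x \<in> B. gdist X x A0 = n * gdist X x A1}"
      by (intro clo cont A continuous_on_mult continuous_on_const)
    moreover have "closed {x \<in> B. gdist X x A2 = l2 * gdist X x A0}"
      by (intro clo cont A continuous_on_mult continuous_on_const)
    ultimately have "compact C" unfolding C_Int by (intro compact_Int_closed B)
    moreover have CB: "C \<subseteq> B" using near by (auto simp: C_eq B_def)
    ultimately obtain x where x: "x \<in> C" "\<And>y. y \<in> C \<Longrightarrow> gdist X x A0 \<le> gdist X y A0"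
      using continuous_attains_inf[of C "\<lambda>x. gdist X x A0"] PC continuous_on_subset[OF cont[OF A(1)]] by blast
    then have "x \<in> surface_points X A0 A1 A2 n l2" by (simp add: surface_points_def C_def)
    then have "x \<in> triangle_surface X A0 A1 A2"
      unfolding triangle_surface_def using n l2
      by (intro UnionI[of "surface_points X A0 A1 A2 n l2"] CollectI exI[of _ n] exI[of _ l2])
        (auto simp: add_pos_pos)
    then show ?thesis using near[OF x(1)] x(1) CB unfolding d_def[symmetric] by (auto simp: B_def)
  qed
qed

text \<open>Ratio 0 puts \<open>A0\<close> and \<open>A2\<close> on the surface. If W missed
  \<open>A1\<close>, the points of W in a compact ball would keep a positive distance from it,
  against the surface points found arbitrarily near.\<close>

lemma vertices_in_plane:
  assumes A: "A0 \<in> points X" "A1 \<in> points X" "A2 \<in> points X"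
    and c: "geodesic_through X A0 A1 c" and ne: "A0 \<noteq> A1"
    and W: "closed W" "triangle_surface X A0 A1 A2 \<subseteq> W"
  shows "A0 \<in> W" "A1 \<in> W" "A2 \<in> W"
proof -
  have "A2 \<in> surface_points X A0 A1 A2 1 0" "A0 \<in> surface_points X A0 A1 A2 0 1"
    by (simp_all add: surface_points_def apollonius_curve_def)
  moreover have "surface_points X A0 A1 A2 1 0 \<subseteq> triangle_surface X A0 A1 A2"
    "surface_points X A0 A1 A2 0 1 \<subseteq> triangle_surface X A0 A1 A2"
    unfolding triangle_surface_def
    by (rule Union_upper, rule CollectI, intro exI conjI, rule refl, simp, simp, simp)+
  ultimately show "A0 \<in> W" "A2 \<in> W" using W by auto
  show "A1 \<in> W"
  proof (rule ccontr)
    assume notin: "A1 \<notin> W"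
    define d where "d = gdist X A0 A1"
    have d: "0 < d" using gdist_nonneg[OF A(1,2)] gdist_eq_0[OF A(1,2)] ne by (simp add: d_def less_le)
    define K where "K = {x \<in> points X. gdist X x A1 \<le> 1} \<inter> W"
    have K: "compact K" unfolding K_def by (intro compact_Int_closed compact_gdist_ball A W)
    have cont: "continuous_on K (\<lambda>x. gdist X x A1)"
      using continuous_on_gdist[OF A(2)] by (rule continuous_on_subset) (auto simp: K_def)
    have "\<exists>\<delta>>0. \<forall>x\<in>K. \<delta> \<le> gdist X x A1"
    proof (cases "K = {}")
      case True
      then show ?thesis by (intro exI[of _ 1]) auto
    next
      case False
      then obtain x where x: "x \<in> K" "\<forall>y\<in>K. gdist X x A1 \<le> gdist X y A1"
        using continuous_attains_inf[OF K _ cont] by blast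
      then have "x \<in> points X" "x \<noteq> A1" using notin by (auto simp: K_def)
      then have "gdist X x A1 > 0" using gdist_nonneg[of x X A1] gdist_eq_0[of x X A1] A by (simp add: less_le)
      with x show ?thesis by blast
    qed
    then obtain \<delta> where \<delta>: "\<delta> > 0" "\<And>x. x \<in> K \<Longrightarrow> \<delta> \<le> gdist X x A1" by blast
    define e where "e = min 1 (\<delta> / 2)"
    have e: "0 < e" "e \<le> 1" "e < \<delta>" using \<delta> by (auto simp: e_def)
    \<comment> \<open>n = 1 + d / e turns the bound d / (n - 1) into e.\<close>
    have "1 < 1 + d / e" using d e by simp
    from surface_point_near_vertex[OF A c ne this] obtain x
      where x: "x \<in> triangle_surface X A0 A1 A2" "x \<in> points X" "gdist X x A1 \<le> d / (d / e)"
      by (auto simp: d_def)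
    then have "gdist X x A1 \<le> e" using d by simp
    moreover have "x \<in> W" using x W by auto
    ultimately have "x \<in> K" using x e by (auto simp: K_def)
    then show False using \<delta>(2) e \<open>gdist X x A1 \<le> e\<close> by fastforce
  qed
qed

section \<open>Unrolling the plane\<close>

text \<open>The complement of \<open>e1\<close> in the plane is a line on which
  \<open>curv X * form X\<close> is positive, so it contains a unit vector. Leaving
  \<open>e1\<close> free allows the cut to be placed at angle 0.\<close>

lemma plane_frame:
  assumes n: "n \<noteq> 0" and W: "W = {x::real^3. n \<bullet> x = 0}" and e1: "e1 \<in> W" "e1 \<in> unit_points X"
  shows "\<exists>e2. frame X e1 e2 \<and> W = range (\<lambda>(a, b). a *\<^sub>R e1 + b *\<^sub>R e2)"
proof -
  have sub: "subspace W" unfolding W by (rule subspace_hyperplane)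
  have dim: "dim W = 2" unfolding W using dim_hyperplane[OF n] by simp
  have ne: "e1 \<noteq> 0" using e1(2) by (auto simp: unit_points_def form_bilinear_simps)
  have "\<not> W \<subseteq> span {e1}"
    using span_card_ge_dim[of W "{e1}"] dim dim_subset[of W "span {e1}"] dim_le_card'[of "{e1}"]
    by (auto simp: dim_span)
  then obtain x where x: "x \<in> W" "x \<notin> span {e1}" by blast
  let ?y = "x - form X e1 x *\<^sub>R e1"
  have "?y \<noteq> 0"
    using x(2) by (metis eq_iff_diff_eq_0 span_base span_mul singletonI)
  moreover have "form X e1 ?y = 0" using e1 by (simp add: unit_points_def form_bilinear_simps)
  ultimately obtain a where f: "frame X e1 (a *\<^sub>R ?y)" using frame_normalize[OF e1(2)] by blast
  define e2 where "e2 = a *\<^sub>R ?y"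
  have e2: "e2 \<in> W" unfolding e2_def using sub e1 x by (intro subspace_mul subspace_diff)
  have f: "frame X e1 e2" using f by (simp add: e2_def)
  have f': "form X e1 e1 = 1" "form X e1 e2 = 0" "form X e2 e2 = curv X"
    using f by (auto simp: frame_def unit_points_def)
  have ni: "e2 \<notin> span {e1}"
  proof
    assume "e2 \<in> span {e1}"
    then obtain k where "e2 = k *\<^sub>R e1" by (auto simp: span_singleton)
    then show False using f' curv_cases[of X] by (auto simp: form_bilinear_simps)
  qed
  have "e2 \<noteq> e1" using ni by (auto intro: span_base)
  then have "independent {e2, e1}"
    using ni ne by (simp add: independent_insert)
  moreover have "card {e2, e1} = 2" using \<open>e2 \<noteq> e1\<close> by simp
  ultimately have "W \<subseteq> span {e2, e1}"
    using e1 e2 dim by (intro card_ge_dim_independent) auto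
  moreover have "span {e2, e1} \<subseteq> W" using e1 e2 sub by (intro span_minimal) auto
  ultimately have "W = span {e2, e1}" by blast
  also have "\<dots> = range (\<lambda>(a, b). a *\<^sub>R e1 + b *\<^sub>R e2)"
    by (auto simp: span_insert span_singleton image_iff algebra_simps) (metis diff_add_cancel add.commute)+
  finally show ?thesis using f by blast
qed

lemma plane_unit_point:
  assumes f: "frame X e1 e2" and x: "a *\<^sub>R e1 + b *\<^sub>R e2 \<in> unit_points X"
  shows "\<exists>\<phi>. a *\<^sub>R e1 + b *\<^sub>R e2 = rot X e1 e2 \<phi>"
proof -
  have e: "form X e1 e1 = 1" "form X e1 e2 = 0" "form X e2 e1 = 0" "form X e2 e2 = curv X" "e1 \<in> unit_points X"
    using f form_commute[of X e2 e1] by (auto simp: frame_def unit_points_def)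
  let ?\<theta> = "unit_dist X e1 (a *\<^sub>R e1 + b *\<^sub>R e2)"
  have "form X e1 (a *\<^sub>R e1 + b *\<^sub>R e2) = a" by (simp add: form_bilinear_simps e)
  then have a: "cs X ?\<theta> = a" using cs_unit_dist[OF e(5) x] by simp
  have "form X (a *\<^sub>R e1 + b *\<^sub>R e2) (a *\<^sub>R e1 + b *\<^sub>R e2) = a\<^sup>2 + curv X * b\<^sup>2"
    by (simp add: form_bilinear_simps e power2_eq_square)
  then have "a\<^sup>2 + curv X * b\<^sup>2 = 1" using x by (simp add: unit_points_def)
  then have "curv X * (1 - a\<^sup>2) = b\<^sup>2" using curv_square(1)[of X] by algebra
  then have "(sn X ?\<theta>)\<^sup>2 = b\<^sup>2" using curv_sn_square[of X ?\<theta>] a by simp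
  then consider "b = sn X ?\<theta>" | "b = sn X (- ?\<theta>)" by (auto simp: power2_eq_iff)
  then show ?thesis
  proof cases
    case 1
    then have "a *\<^sub>R e1 + b *\<^sub>R e2 = rot X e1 e2 ?\<theta>" by (simp add: rot_def a)
    then show ?thesis ..
  next
    case 2
    then have "a *\<^sub>R e1 + b *\<^sub>R e2 = rot X e1 e2 (- ?\<theta>)" by (simp add: rot_def a)
    then show ?thesis ..
  qed
qed

text \<open>The plane contains just two unit tangent vectors at \<open>rot X e1 e2 \<alpha>\<close>,
  so a rotation from there runs forwards or backwards. The sign \<epsilon> is the determinant of (C,
  S) and (a, b).\<close>

lemma plane_rot:
  assumes f: "frame X e1 e2" and uw: "frame X (rot X e1 e2 \<alpha>) (a *\<^sub>R e1 + b *\<^sub>R e2)"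
  shows "\<exists>\<epsilon>::real. \<epsilon>\<^sup>2 = 1 \<and> (\<forall>\<theta>. rot X (rot X e1 e2 \<alpha>) (a *\<^sub>R e1 + b *\<^sub>R e2) \<theta> = rot X e1 e2 (\<alpha> + \<epsilon> * \<theta>))"
proof -
  have e: "form X e1 e1 = 1" "form X e1 e2 = 0" "form X e2 e1 = 0" "form X e2 e2 = curv X"
    using f form_commute[of X e2 e1] by (auto simp: frame_def unit_points_def)
  define C S where "C = cs X \<alpha>" and "S = sn X \<alpha>"
  have CS: "C * C + curv X * S * S = 1"
    using cs_sn_square[of X \<alpha>] by (simp add: C_def S_def power2_eq_square)
  have 1: "C * a + curv X * S * b = 0"
    using uw by (simp add: frame_def rot_def form_bilinear_simps e C_def S_def mult_ac)
  have 2: "a * a + curv X * b * b = curv X"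
    using uw by (simp add: frame_def form_bilinear_simps e mult_ac)
  define \<epsilon> where "\<epsilon> = b * C - a * S"
  have ab: "b = \<epsilon> * C" "a = - curv X * \<epsilon> * S"
    using CS 1 curv_square(1)[of X] unfolding \<epsilon>_def by algebra+
  have "curv X * \<epsilon>\<^sup>2 = curv X"
  proof -
    have "curv X * \<epsilon>\<^sup>2 = curv X * \<epsilon>\<^sup>2 * (C * C + curv X * S * S)" by (simp add: CS)
    also have "\<dots> = a * a + curv X * b * b"
      unfolding ab by (simp add: algebra_simps power2_eq_square)
    finally show ?thesis using 2 by simp
  qed
  then have "\<epsilon>\<^sup>2 = 1" using curv_cases[of X] by auto
  then have "\<epsilon> = 1 \<or> \<epsilon> = - 1" by (simp add: power2_eq_1_iff)
  then have "rot X (rot X e1 e2 \<alpha>) (a *\<^sub>R e1 + b *\<^sub>R e2) \<theta> = rot X e1 e2 (\<alpha> + \<epsilon> * \<theta>)" for \<theta>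
    unfolding ab by (auto simp: rot_def cs_add sn_add cs_diff sn_diff C_def S_def algebra_simps)
  with \<open>\<epsilon>\<^sup>2 = 1\<close> show ?thesis by blast
qed

definition chart :: "geometry \<Rightarrow> real^3 \<Rightarrow> real^3 \<Rightarrow> real \<Rightarrow> real \<Rightarrow> real^3" where
  "chart X e1 e2 \<phi> t = exp t *\<^sub>R rot X e1 e2 \<phi>"

text \<open>On the sphere the open period cuts the cylinder along the fibre of
  \<open>e1\<close>.\<close>

definition chart_domain :: "geometry \<Rightarrow> real set" where
  "chart_domain X = (if X = S2xR then {0<..<2 * pi} else UNIV)"

text \<open>The point determines height and direction, and the direction fixes the angle up to a
  period, which the cut resolves. This is what identifies the coordinates of a vertex computed on
  two different sides.\<close>

lemma chart_inject:
  assumes f: "frame X e1 e2" and "\<phi> \<in> chart_domain X" "\<phi>' \<in> chart_domain X"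
    and eq: "chart X e1 e2 \<phi> t = chart X e1 e2 \<phi>' t'"
  shows "\<phi> = \<phi>'" "t = t'"
proof -
  note unit = rot_unit_points[OF f]
  show "t = t'" using scaled_unit_point(2)[OF unit] eq unfolding chart_def by metis
  have r: "rot X e1 e2 \<phi> = rot X e1 e2 \<phi>'" using scaled_unit_point(3)[OF unit] eq unfolding chart_def by metis
  have e: "form X e1 e1 = 1" "form X e1 e2 = 0" "form X e2 e1 = 0" "form X e2 e2 = curv X"
    using f form_commute[of X e2 e1] by (auto simp: frame_def unit_points_def)
  have 1: "form X e1 (rot X e1 e2 a) = cs X a" "form X e2 (rot X e1 e2 a) = sn X a * curv X" for a
    by (simp_all add: rot_def form_bilinear_simps e)
  have cs: "cs X \<phi> = cs X \<phi>'" using 1(1)[of \<phi>] 1(1)[of \<phi>'] r by simp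
  have "sn X \<phi> * curv X = sn X \<phi>' * curv X" by (metis 1(2) r)
  then have sn: "sn X \<phi> = sn X \<phi>'" using curv_cases[of X] by (elim disjE) simp_all
  show "\<phi> = \<phi>'"
  proof (cases X)
    case S2xR
    then obtain n where n: "\<phi> = \<phi>' + 2 * pi * of_int n"
      using cs sn sin_cos_eq_iff[of \<phi> \<phi>'] by (auto simp: cs_def sn_def)
    have "\<phi> \<in> {0<..<2 * pi}" "\<phi>' \<in> {0<..<2 * pi}"
      using assms(2,3) S2xR by (simp_all add: chart_domain_def)
    then have "\<bar>2 * pi * of_int n\<bar> < 2 * pi * 1"
      using n unfolding greaterThanLessThan_iff by linarith
    then have "\<bar>real_of_int n\<bar> < 1" by (simp add: abs_mult)
    then show ?thesis using n by simp
  next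
    case H2xR
    then show ?thesis using sn by (simp add: sn_def)
  qed
qed

text \<open>
  A screw whose angle varies by more than a half turn passes through two pairs of antipodal
  directions, but a half great circle contains only one such pair.
\<close>

lemma within_semicircle_short:
  assumes f: "frame S2xR u w" and sc: "within_semicircle (arc_of (screw S2xR u w \<omega> \<tau> t) T)"
    and ab: "a \<in> T" "b \<in> T" and \<omega>: "0 \<le> \<omega>"
  shows "short S2xR (\<omega> * (b - a))"
  using ab
proof (induction a b rule: linorder_wlog)
  case (sym a b)
  then show ?case by (simp add: short_def algebra_simps abs_minus_commute)
next
  case (le a b)
  show ?case
  proof (rule ccontr)
    assume "\<not> short S2xR (\<omega> * (b - a))"
    moreover have "0 \<le> \<omega> * (b - a)" using \<omega> le by simp
    ultimately have big: "pi < \<omega> * (b - a)" by (simp add: short_def)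
    with \<omega> have pos: "0 < \<omega>" by (cases "\<omega> = 0") auto
    let ?r = "rot S2xR u w"
    obtain u0 w0 where uw0: "norm u0 = 1" "norm w0 = 1" "u0 \<bullet> w0 = 0"
      "\<And>x. x \<in> arc_of (screw S2xR u w \<omega> \<tau> t) T \<Longrightarrow> \<exists>s\<in>{0..pi}. x /\<^sub>R norm x = cos s *\<^sub>R u0 + sin s *\<^sub>R w0"
      using sc unfolding within_semicircle_def by blast
    have seg: "{a..b} \<subseteq> convex hull T"
    proof -
      have "closed_segment a b \<subseteq> convex hull T"
        using le by (intro closed_segment_subset_convex_hull) (auto intro: hull_inc)
      then show ?thesis using le by (simp add: closed_segment_eq_real_ivl)
    qed
    have dir: "\<exists>s\<in>{0..pi}. ?r (\<omega> * y) = cos s *\<^sub>R u0 + sin s *\<^sub>R w0" if "y \<in> {a..b}" for y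
    proof -
      let ?x = "screw S2xR u w \<omega> \<tau> t y"
      have "?x \<in> arc_of (screw S2xR u w \<omega> \<tau> t) T"
        using that seg unfolding arc_of_def by (intro imageI) auto
      moreover have "?x /\<^sub>R norm ?x = dir S2xR ?x"
        by (simp add: dir_def form_def norm_eq_sqrt_inner)
      ultimately show ?thesis using uw0(4)[of ?x] screw_points(3)[OF f] by simp
    qed
    have i: "u0 \<bullet> u0 = 1" "w0 \<bullet> w0 = 1" "w0 \<bullet> u0 = 0"
      using uw0 by (auto simp: dot_square_norm inner_commute)
    \<comment> \<open>On the half circle the component along \<open>w0\<close> is nonnegative, so it
      vanishes at a direction whose antipode is also on the half circle.\<close>
    have anti: "?r (\<omega> * y) = u0 \<or> ?r (\<omega> * y) = - u0" if y: "a \<le> y" "y + pi / \<omega> \<le> b" for y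
    proof -
      have "y \<le> y + pi / \<omega>" using pos by simp
      then have "y \<in> {a..b}" "y + pi / \<omega> \<in> {a..b}" using y by auto
      then obtain s s' where s: "s \<in> {0..pi}" "?r (\<omega> * y) = cos s *\<^sub>R u0 + sin s *\<^sub>R w0"
        and s': "s' \<in> {0..pi}" "?r (\<omega> * (y + pi / \<omega>)) = cos s' *\<^sub>R u0 + sin s' *\<^sub>R w0"
        using dir by meson
      have "\<omega> * (y + pi / \<omega>) = \<omega> * y + pi" using pos by (simp add: field_simps)
      then have "?r (\<omega> * (y + pi / \<omega>)) = - ?r (\<omega> * y)"
        by (simp add: rot_def cs_def sn_def)
      then have "w0 \<bullet> (cos s' *\<^sub>R u0 + sin s' *\<^sub>R w0) = - (w0 \<bullet> (cos s *\<^sub>R u0 + sin s *\<^sub>R w0))"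
        by (simp only: s(2) s'(2) inner_minus_right)
      then have "sin s' = - sin s" by (simp add: inner_simps i)
      moreover have "0 \<le> sin s" "0 \<le> sin s'" using s s' by (auto intro: sin_ge_zero)
      ultimately have sin: "sin s = 0" by simp
      then have "cos s = 1 \<or> cos s = - 1" using sin_zero_abs_cos_one[of s] by (auto simp: abs_if split: if_splits)
      with sin s show ?thesis by auto
    qed
    \<comment> \<open>Both a and a + d have antipodal partners on the arc, so their directions agree
      up to sign, although they differ by a positive angle of at most 1.\<close>
    define d where "d = min (1 / \<omega>) (b - a - pi / \<omega>)"
    have "pi / \<omega> < b - a" using big pos by (simp add: field_simps)
    then have d: "0 < d" "d \<le> 1 / \<omega>" "d \<le> b - a - pi / \<omega>"
      unfolding d_def using pos by (simp_all only: min.cobounded1 min.cobounded2) simp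
    have "?r (\<omega> * a) = u0 \<or> ?r (\<omega> * a) = - u0" "?r (\<omega> * (a + d)) = u0 \<or> ?r (\<omega> * (a + d)) = - u0"
      using d by (intro anti; simp)+
    then have "(form S2xR (?r (\<omega> * (a + d))) (?r (\<omega> * a)))\<^sup>2 = 1"
      using i by (auto simp: form_def)
    then have "(cos (\<omega> * d))\<^sup>2 = 1"
      unfolding form_rot_rot[OF f] by (simp add: cs_def algebra_simps)
    then have "sin (\<omega> * d) = 0" by (simp add: cos_squared_eq)
    moreover have "\<omega> * d \<le> 1" using mult_left_mono[OF d(2), of \<omega>] pos by simp
    then have "0 < sin (\<omega> * d)" using pos d pi_gt3 by (intro sin_gt_zero) (auto simp del: pi_gt3)
    ultimately show False by simp
  qed
qed

text \<open>The angles along the arc form an interval without multiples of 2 pi, so they stay in one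
  open period; the floor at one parameter selects it.\<close>

lemma affine_hull_chart_domain:
  fixes \<alpha> \<omega> :: real
  assumes avoid: "\<And>s (k::int). s \<in> convex hull T \<Longrightarrow> \<alpha> + \<omega> * s \<noteq> 2 * pi * k" and T: "T \<noteq> {}"
  shows "\<exists>k::int. \<forall>s\<in>convex hull T. \<alpha> - 2 * pi * k + \<omega> * s \<in> {0<..<2 * pi}"
proof -
  obtain s0 where s0: "s0 \<in> convex hull T" using T by (auto intro: hull_inc)
  define k where "k = \<lfloor>(\<alpha> + \<omega> * s0) / (2 * pi)\<rfloor>"
  let ?f = "\<lambda>s. \<alpha> - 2 * pi * k + \<omega> * s"
  have "of_int k \<le> (\<alpha> + \<omega> * s0) / (2 * pi)" "(\<alpha> + \<omega> * s0) / (2 * pi) < of_int k + 1"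
    unfolding k_def by linarith+
  then have f0: "0 \<le> ?f s0" "?f s0 < 2 * pi"
    by (simp_all add: field_simps)
  have con: "connected (?f ` (convex hull T))"
    by (intro connected_continuous_image continuous_intros convex_connected convex_convex_hull)
  have av: "?f s \<noteq> 0" "?f s \<noteq> 2 * pi" if "s \<in> convex hull T" for s
    using avoid[OF that, of k] avoid[OF that, of "k + 1"] by (auto simp: algebra_simps)
  have "?f s \<in> {0<..<2 * pi}" if s: "s \<in> convex hull T" for s
  proof (rule ccontr)
    assume "?f s \<notin> {0<..<2 * pi}"
    then consider "?f s \<le> 0" | "2 * pi \<le> ?f s" by fastforce
    then show False
    proof cases
      case 1
      then have "0 \<in> {?f s..?f s0}" using f0 by simp
      then have "0 \<in> ?f ` (convex hull T)"
        using connected_contains_Icc[OF con, of "?f s" "?f s0"] s s0 by blast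
      then show False using av(1) by force
    next
      case 2
      then have "2 * pi \<in> {?f s0..?f s}" using f0 by simp
      then have "2 * pi \<in> ?f ` (convex hull T)"
        using connected_contains_Icc[OF con, of "?f s0" "?f s"] s s0 by blast
      then show False using av(2) by force
    qed
  qed
  then show ?thesis by blast
qed

text \<open>In the coordinates (angle, height) a screw in the plane is a straight line, with
  \<omega>' = \<omega> or - \<omega> according to orientation. On the sphere the angle is shifted by
  a period into the cut domain. A fibre does not involve w, hence the alternative \<omega> =
  0.\<close>

lemma plane_screw_chart:
  assumes f: "frame X e1 e2" and W: "W = range (\<lambda>(a, b). a *\<^sub>R e1 + b *\<^sub>R e2)"
    and uw: "frame X u w" "u \<in> W" "\<omega> = 0 \<or> w \<in> W" and T: "T \<noteq> {}"
    and avoid: "X = S2xR \<Longrightarrow> \<forall>r>0. r *\<^sub>R e1 \<notin> arc_of (screw X u w \<omega> \<tau> t) T"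
  shows "\<exists>\<alpha> \<omega>'. \<omega>'\<^sup>2 = \<omega>\<^sup>2 \<and> (\<forall>s. screw X u w \<omega> \<tau> t s = chart X e1 e2 (\<alpha> + \<omega>' * s) (t + \<tau> * s))
    \<and> (\<forall>s\<in>convex hull T. \<alpha> + \<omega>' * s \<in> chart_domain X)"
proof -
  have "u \<in> unit_points X" using uw(1) by (simp add: frame_def)
  then obtain \<alpha> where \<alpha>: "u = rot X e1 e2 \<alpha>"
    using uw(2) plane_unit_point[OF f] unfolding W by (auto simp: case_prod_beta)
  have "\<exists>\<omega>'. \<omega>'\<^sup>2 = \<omega>\<^sup>2 \<and> (\<forall>s. rot X u w (\<omega> * s) = rot X e1 e2 (\<alpha> + \<omega>' * s))"
  proof (cases "\<omega> = 0")
    case True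
    then show ?thesis by (intro exI[of _ 0]) (simp add: \<alpha>)
  next
    case False
    then obtain a b where w: "w = a *\<^sub>R e1 + b *\<^sub>R e2" using uw(3) unfolding W by auto
    obtain \<epsilon> :: real where "\<epsilon>\<^sup>2 = 1" "\<And>\<theta>. rot X u w \<theta> = rot X e1 e2 (\<alpha> + \<epsilon> * \<theta>)"
      using plane_rot[OF f] uw(1) unfolding \<alpha> w by blast
    then show ?thesis by (intro exI[of _ "\<epsilon> * \<omega>"]) (simp add: power_mult_distrib mult.assoc)
  qed
  then obtain \<omega>' where \<omega>': "\<omega>'\<^sup>2 = \<omega>\<^sup>2" "\<And>s. rot X u w (\<omega> * s) = rot X e1 e2 (\<alpha> + \<omega>' * s)" by blast
  have c: "screw X u w \<omega> \<tau> t s = chart X e1 e2 (\<alpha> + \<omega>' * s) (t + \<tau> * s)" for s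
    by (simp add: screw_def chart_def \<omega>'(2))
  show ?thesis
  proof (cases X)
    case H2xR
    then show ?thesis using \<omega>'(1) c by (auto simp: chart_domain_def)
  next
    case S2xR
    have "\<alpha> + \<omega>' * s \<noteq> 2 * pi * real_of_int k" if s: "s \<in> convex hull T" for s and k :: int
    proof
      assume "\<alpha> + \<omega>' * s = 2 * pi * real_of_int k"
      then have "screw X u w \<omega> \<tau> t s = exp (t + \<tau> * s) *\<^sub>R e1"
        unfolding c chart_def rot_def using S2xR cos_int_2pin[of k] sin_int_2pin[of k]
        by (simp add: cs_def sn_def)
      moreover have "screw X u w \<omega> \<tau> t s \<in> arc_of (screw X u w \<omega> \<tau> t) T"
        using s by (simp add: arc_of_def)
      ultimately show False using avoid[OF S2xR] exp_gt_zero by metis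
    qed
    from affine_hull_chart_domain[OF this T] obtain k :: int
      where k: "\<And>s. s \<in> convex hull T \<Longrightarrow> \<alpha> - 2 * pi * k + \<omega>' * s \<in> {0<..<2 * pi}" by blast
    have "cos (\<alpha> - 2 * pi * k + \<omega>' * s) = cos (\<alpha> + \<omega>' * s)" "sin (\<alpha> - 2 * pi * k + \<omega>' * s) = sin (\<alpha> + \<omega>' * s)" for s
      using cos_int_2pin[of k] sin_int_2pin[of k] cos_diff[of "\<alpha> + \<omega>' * s" "2 * pi * k"] sin_diff[of "\<alpha> + \<omega>' * s" "2 * pi * k"]
      by (simp_all add: algebra_simps)
    then have "chart X e1 e2 (\<alpha> - 2 * pi * k + \<omega>' * s) r = chart X e1 e2 (\<alpha> + \<omega>' * s) r" for s r
      using S2xR by (simp add: chart_def rot_def cs_def sn_def)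
    then show ?thesis using \<omega>'(1) c k S2xR
      by (intro exI[of _ "\<alpha> - 2 * pi * k"] exI[of _ \<omega>']) (simp add: chart_domain_def)
  qed
qed

section \<open>Menelaus' theorem\<close>

lemma sn_eq_0_short:
  assumes "sn X x = 0" "short X x" "x \<noteq> 0"
  shows "X = S2xR" "\<bar>x\<bar> = pi"
proof -
  have "sn X \<bar>x\<bar> = 0" using assms(1) by (auto simp: abs_if)
  then have "\<not> (X = S2xR \<longrightarrow> \<bar>x\<bar> < pi)" using sn_pos[of "\<bar>x\<bar>" X] assms(3) by auto
  with assms(2) show "X = S2xR" "\<bar>x\<bar> = pi" by (auto simp: short_def)
qed

text \<open>Two directions of the great circle lie in W; unless they are equal or opposite, they
  span its plane.\<close>

lemma screw_plane:
  assumes W: "subspace W" and u: "u \<in> W" and p: "screw X u w \<omega> \<tau> t p \<in> W" and sn: "sn X (\<omega> * p) \<noteq> 0"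
  shows "w \<in> W"
proof -
  have "exp (- (t + \<tau> * p)) *\<^sub>R screw X u w \<omega> \<tau> t p \<in> W"
    using W p by (rule subspace_mul)
  then have "rot X u w (\<omega> * p) \<in> W" by (simp add: screw_def flip: exp_add)
  then have "rot X u w (\<omega> * p) - cs X (\<omega> * p) *\<^sub>R u \<in> W"
    using W u by (intro subspace_diff subspace_mul)
  then have "sn X (\<omega> * p) *\<^sub>R w \<in> W" by (simp add: rot_def)
  then have "(1 / sn X (\<omega> * p)) *\<^sub>R (sn X (\<omega> * p) *\<^sub>R w) \<in> W" by (rule subspace_mul[OF W])
  then show ?thesis using sn by simp
qed

lemma screw_base_plane:
  assumes W: "subspace W" and "screw X u w \<omega> \<tau> t 0 \<in> W"
  shows "u \<in> W"
proof -
  have "exp (- t) *\<^sub>R screw X u w \<omega> \<tau> t 0 \<in> W" using assms by (rule subspace_mul)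
  then show ?thesis by (simp add: screw_def flip: exp_add)
qed

lemma geodesic_through_points:
  assumes "geodesic_through X A B c"
  shows "c s \<in> points X" "A \<in> points X" "B \<in> points X"
proof -
  have "range c \<subseteq> points X" using assms by (simp add: geodesic_through_def geodesic_def)
  then show pts: "c s \<in> points X" for s by blast
  show "A \<in> points X" "B \<in> points X"
    using assms pts[of 0] pts[of "gdist X A B"] by (simp_all add: geodesic_through_def)
qed

text \<open>Serves the third ratio, which runs from \<open>A2\<close> to \<open>A0\<close> while
  \<open>g02\<close> starts at \<open>A0\<close>.\<close>

lemma geodesic_through_reverse:
  assumes "geodesic_through X A B c"
  shows "geodesic_through X B A (\<lambda>s. c (gdist X A B - s))"
proof -
  let ?d = "gdist X A B"
  have c: "geodesic X c" "c 0 = A" "c ?d = B" using assms by (auto simp: geodesic_through_def)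
  have d: "gdist X B A = ?d" using geodesic_through_points(2,3)[OF assms] by (rule gdist_commute[symmetric])
  have "geodesic X (\<lambda>s. c (?d - s))"
    unfolding geodesic_def
  proof (intro conjI allI)
    show "range (\<lambda>s. c (?d - s)) \<subseteq> points X" using c(1) by (auto simp: geodesic_def)
    fix s
    obtain e where e: "e > 0"
      "\<And>a b. a \<in> {?d-s-e..?d-s+e} \<Longrightarrow> b \<in> {?d-s-e..?d-s+e} \<Longrightarrow> gdist X (c a) (c b) = \<bar>a - b\<bar>"
      using c(1) unfolding geodesic_def by meson
    have "gdist X (c (?d - a)) (c (?d - b)) = \<bar>a - b\<bar>" if "a \<in> {s-e..s+e}" "b \<in> {s-e..s+e}" for a b
      using e(2)[of "?d - a" "?d - b"] that by (simp add: abs_minus_commute)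
    with e(1) show "\<exists>e>0. \<forall>a\<in>{s-e..s+e}. \<forall>b\<in>{s-e..s+e}. gdist X (c (?d - a)) (c (?d - b)) = \<bar>a - b\<bar>"
      by blast
  qed
  then show ?thesis using c d by (simp add: geodesic_through_def)
qed

text \<open>With d the distance of A and B, the quotient p / (d - p) is positive exactly between the
  end points. Over antipodal directions several geodesics join A and B, but the distances to A and B
  fix the parameter on each of them, so betweenness does not depend on the choice.\<close>

lemma simply_ratio_eq:
  assumes c: "geodesic_through X A B c" and P: "c p = P"
    and dist: "gdist X A P = \<bar>p\<bar>" "gdist X P B = \<bar>gdist X A B - p\<bar>"
    and ne: "p \<noteq> 0" "p \<noteq> gdist X A B" and d: "0 \<le> gdist X A B"
  shows "simply_ratio X A P B = p / (gdist X A B - p)"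
proof -
  let ?d = "gdist X A B"
  have "geodesic_between X A P B \<longleftrightarrow> 0 < p \<and> p < ?d"
  proof
    assume "geodesic_between X A P B"
    then obtain c' s where c': "geodesic_through X A B c'" "P = c' s" "0 < s" "s < ?d"
      unfolding geodesic_between_def by auto
    then have "\<bar>p\<bar> = s" "\<bar>?d - p\<bar> = ?d - s"
      using geodesic_through_gdist[OF c'(1), of s] dist by simp_all
    with c' show "0 < p \<and> p < ?d" by (auto simp: abs_if split: if_splits)
  next
    assume "0 < p \<and> p < ?d"
    then show "geodesic_between X A P B"
      unfolding geodesic_between_def using c P by (intro exI[of _ c]) auto
  qed
  then show ?thesis
    unfolding simply_ratio_def dist using ne d by (auto simp: abs_if divide_simps algebra_simps)
qed

text \<open>Along the side line h becomes an affine function H of arc length with zero p;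
  interpolating between 0 and d gives p : (d - p) = - H 0 : H d.\<close>

lemma side_ratio:
  fixes h1 h2 h3 :: real
  assumes f: "frame X e1 e2" and W: "W = range (\<lambda>(a, b). a *\<^sub>R e1 + b *\<^sub>R e2)" "subspace W"
    and AB: "A \<in> W" "B \<in> W" "A \<noteq> B" and g: "geodesic_through X A B g"
    and P: "g p = P" "P \<in> W" "P \<noteq> A" "P \<noteq> B"
    and semi: "X = S2xR \<Longrightarrow> within_semicircle (arc_of g {0, gdist X A B, p})"
    and avoid: "X = S2xR \<Longrightarrow> \<forall>r>0. r *\<^sub>R e1 \<notin> arc_of g {0, gdist X A B, p}"
  defines "h \<equiv> \<lambda>\<phi> t. h1 * \<phi> + h2 * t + h3"
  assumes h0: "\<And>\<phi> t. \<phi> \<in> chart_domain X \<Longrightarrow> chart X e1 e2 \<phi> t = P \<Longrightarrow> h \<phi> t = 0"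
    and hne: "\<And>\<phi> t. \<phi> \<in> chart_domain X \<Longrightarrow> chart X e1 e2 \<phi> t \<in> {A, B} \<Longrightarrow> h \<phi> t \<noteq> 0"
  shows "\<exists>\<phi>A tA \<phi>B tB. \<phi>A \<in> chart_domain X \<and> chart X e1 e2 \<phi>A tA = A
    \<and> \<phi>B \<in> chart_domain X \<and> chart X e1 e2 \<phi>B tB = B
    \<and> simply_ratio X A P B = - h \<phi>A tA / h \<phi>B tB \<and> simply_ratio X B P A = - h \<phi>B tB / h \<phi>A tA"
proof -
  define d where "d = gdist X A B"
  let ?T = "{0, d, p}"
  have gAB: "g 0 = A" "g d = B" using g by (auto simp: geodesic_through_def d_def)
  have pts: "A \<in> points X" "B \<in> points X" "P \<in> points X"
    using geodesic_through_points[OF g] P(1) by auto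
  have d: "0 < d" using gdist_nonneg[OF pts(1,2)] gdist_eq_0[OF pts(1,2)] AB(3) by (simp add: d_def less_le)
  have p: "p \<noteq> 0" "p \<noteq> d" using gAB P by auto
  obtain u w \<omega> \<tau> t where c: "frame X u w" "0 \<le> \<omega>" "\<omega>\<^sup>2 + \<tau>\<^sup>2 = 1" "\<And>s. g s = screw X u w \<omega> \<tau> t s"
    using geodesic_through_screw[OF g] by blast
  then have g_eq: "g = screw X u w \<omega> \<tau> t" by blast
  have short: "short X (\<omega> * (b - a))" if "a \<in> ?T" "b \<in> ?T" for a b
  proof (cases X)
    case S2xR
    with within_semicircle_short[of u w \<omega> \<tau> t ?T a b] c(1,2) semi that show ?thesis
      by (simp add: d_def g_eq)
  qed (simp add: short_def)
  have dist: "gdist X (g a) (g b) = \<bar>a - b\<bar>" if "a \<in> ?T" "b \<in> ?T" for a b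
    unfolding g_eq using that by (intro gdist_screw c short)
  have u: "u \<in> W" using screw_base_plane[OF W(2)] gAB(1) AB(1) unfolding g_eq by blast
  \<comment> \<open>If neither B nor P forced w into W, both would be a half turn away from A. In
    opposite directions they would be a full turn apart, more than the semicircle allows, so p =
    d.\<close>
  have w: "\<omega> = 0 \<or> w \<in> W"
  proof (rule ccontr)
    assume "\<not> (\<omega> = 0 \<or> w \<in> W)"
    then have *: "\<omega> > 0" "w \<notin> W" using c(2) by auto
    have "sn X (\<omega> * d) = 0" "sn X (\<omega> * p) = 0"
      using screw_plane[OF W(2) u] AB P gAB *(2) unfolding g_eq by metis+
    then have "X = S2xR" "\<bar>\<omega> * d\<bar> = pi" "\<bar>\<omega> * p\<bar> = pi"
      using sn_eq_0_short[of X "\<omega> * d"] sn_eq_0_short[of X "\<omega> * p"] short[of 0 d] short[of 0 p] *(1) d p by auto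
    moreover have "\<bar>\<omega> * (d - p)\<bar> \<le> pi" using short[of p d] \<open>X = S2xR\<close> by (simp add: short_def)
    ultimately have "\<omega> * d = \<omega> * p"
      using *(1) d pi_gt_zero mult_pos_pos[OF *(1) d] unfolding right_diff_distrib by linarith
    then show False using * p by simp
  qed
  obtain \<alpha> \<omega>' where ch: "\<And>s. g s = chart X e1 e2 (\<alpha> + \<omega>' * s) (t + \<tau> * s)"
    "\<And>s. s \<in> convex hull ?T \<Longrightarrow> \<alpha> + \<omega>' * s \<in> chart_domain X"
    using plane_screw_chart[OF f W(1) c(1) u w, of ?T \<tau> t] avoid unfolding g_eq d_def by blast
  define H where "H s = h (\<alpha> + \<omega>' * s) (t + \<tau> * s)" for s
  have dom: "\<alpha> + \<omega>' * s \<in> chart_domain X" if "s \<in> ?T" for s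
    using ch(2) hull_inc[OF that] by blast
  have Hp: "H p = 0" unfolding H_def using dom P(1) ch(1)[of p] by (intro h0) auto
  have "H s \<noteq> 0" if "s \<in> {0, d}" for s
    unfolding H_def using that gAB ch(1)[of s] by (intro hne dom) auto
  then have Hne: "H 0 \<noteq> 0" "H d \<noteq> 0" by simp_all
  have "H 0 * (d - p) + H d * p = d * H p"
    by (simp add: H_def h_def algebra_simps)
  then have rel: "p * H d = - (H 0 * (d - p))" using Hp by (simp add: algebra_simps)
  have "simply_ratio X A P B = p / (d - p)"
    unfolding d_def using dist[of 0 p] dist[of p d] gAB P p d
    by (intro simply_ratio_eq[OF g]) (auto simp: d_def abs_minus_commute)
  also have "\<dots> = - H 0 / H d" using rel Hne p by (simp add: field_simps)
  finally have 1: "simply_ratio X A P B = - H 0 / H d" .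
  have dB: "gdist X B A = d" using gdist_commute[OF pts(1,2)] by (simp add: d_def)
  have "simply_ratio X B P A = (d - p) / (gdist X B A - (d - p))"
    using dist[of d p] dist[of p 0] gAB P p d
    by (intro simply_ratio_eq[OF geodesic_through_reverse[OF g]]) (auto simp: dB simp flip: d_def)
  also have "\<dots> = - H d / H 0" unfolding dB using rel Hne p by (simp add: field_simps)
  finally have 2: "simply_ratio X B P A = - H d / H 0" .
  show ?thesis
    using 1 2 dom[of 0] dom[of d] gAB ch(1)[of 0] ch(1)[of d] unfolding H_def
    by (intro exI[of _ "\<alpha> + \<omega>' * 0"] exI[of _ "t + \<tau> * 0"] exI[of _ "\<alpha> + \<omega>' * d"] exI[of _ "t + \<tau> * d"]) simp
qed

text \<open>P, Q and R have parameters on the side lines, where they may lie beyond the vertices,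
  and on l, where these delimit the arc to which the semicircle convention refers.\<close>

theorem theorem4p11:
  fixes X :: geometry
    and A0 A1 A2 P Q R :: "real^3"
    and W :: "(real^3) set"
    and g12 g02 g01 l :: "real \<Rightarrow> real^3"
    and q r p q' r' p' :: real
  assumes triangle: "geodesic_triangle X A0 A1 A2"
    and fibre: "fibre_type_in X A0 A1 A2 W"
    and g12: "geodesic_through X A1 A2 g12"
    and g02: "geodesic_through X A0 A2 g02"
    and g01: "geodesic_through X A0 A1 g01"
    and l: "geodesic X l" "range l \<subseteq> W"
    and no_vertex: "A0 \<notin> range l" "A1 \<notin> range l" "A2 \<notin> range l"
    and Q: "l q' = Q" "g12 q = Q"
    and R: "l r' = R" "g02 r = R"
    and P: "l p' = P" "g01 p = P"
    and convention: "semicircle_convention X W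
      {arc_of g12 {0, gdist X A1 A2, q}, arc_of g02 {0, gdist X A0 A2, r},
       arc_of g01 {0, gdist X A0 A1, p}, arc_of l {q', r', p'}}"
  shows "simply_ratio X A0 P A1 * simply_ratio X A1 Q A2 * simply_ratio X A2 R A0 = -1"
proof -
  let ?arcs = "{arc_of g12 {0, gdist X A1 A2, q}, arc_of g02 {0, gdist X A0 A2, r},
       arc_of g01 {0, gdist X A0 A1, p}, arc_of l {q', r', p'}}"
  obtain n where n: "n \<noteq> 0" and W: "W = {x. n \<bullet> x = 0}"
    using fibre by (auto simp: fibre_type_in_def plane_through_centre_def)
  have sub: "subspace W" unfolding W by (rule subspace_hyperplane)
  have pts: "A0 \<in> points X" "A1 \<in> points X" "A2 \<in> points X"
    and ne: "A0 \<noteq> A1" "A1 \<noteq> A2" "A0 \<noteq> A2"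
    using triangle by (auto simp: geodesic_triangle_def)
  have "closed W" using sub by (rule closed_subspace)
  then have AW: "A0 \<in> W" "A1 \<in> W" "A2 \<in> W"
    using vertices_in_plane[OF pts g01 ne(1)] fibre by (auto simp: fibre_type_in_def)
  \<comment> \<open>On the sphere \<open>e1\<close> points along the missed fibre. In the hyperbolic
    case nothing is cut, and the direction of \<open>A0\<close> serves.\<close>
  have "\<exists>e1\<in>W. e1 \<in> unit_points X \<and> (X = S2xR \<longrightarrow> (\<forall>r>0. r *\<^sub>R e1 \<notin> \<Union>?arcs))"
  proof (cases X)
    case H2xR
    have "dir X A0 \<in> W" unfolding dir_def using sub AW(1) by (rule subspace_mul)
    then show ?thesis using dir_unit_points[OF pts(1)] H2xR by blast
  next
    case S2xR
    then obtain v where v: "v \<in> W" "v \<noteq> 0" "\<And>c. c > 0 \<Longrightarrow> c *\<^sub>R v \<notin> \<Union>?arcs"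
      using convention unfolding semicircle_convention_def by blast
    have "r *\<^sub>R (v /\<^sub>R norm v) \<notin> \<Union>?arcs" if "r > 0" for r
      using v(3)[of "r / norm v"] that v(2) by (simp add: divide_inverse)
    moreover have "v /\<^sub>R norm v \<in> W" using sub v(1) by (rule subspace_mul)
    moreover have "v /\<^sub>R norm v \<in> unit_points X"
      using v(2) S2xR by (simp add: unit_points_def form_def flip: power2_norm_eq_inner)
    ultimately show ?thesis by blast
  qed
  then obtain e1 where e1: "e1 \<in> W" "e1 \<in> unit_points X"
    and avoid: "\<And>a. X = S2xR \<Longrightarrow> a \<in> ?arcs \<Longrightarrow> \<forall>r>0. r *\<^sub>R e1 \<notin> a"
    by blast
  have semi: "within_semicircle a" if "X = S2xR" "a \<in> ?arcs" for a
    using convention that unfolding semicircle_convention_def by blast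
  obtain e2 where f: "frame X e1 e2" and W_range: "W = range (\<lambda>(a, b). a *\<^sub>R e1 + b *\<^sub>R e2)"
    using plane_frame[OF n W e1] by blast
  obtain u w \<omega> \<tau> t where c: "frame X u w" "0 \<le> \<omega>" "\<omega>\<^sup>2 + \<tau>\<^sup>2 = 1" "\<And>s. l s = screw X u w \<omega> \<tau> t s"
    using geodesic_screw[OF l(1)] by blast
  then have l_eq: "l = screw X u w \<omega> \<tau> t" by blast
  have lW: "screw X u w \<omega> \<tau> t s \<in> W" for s using l(2) unfolding l_eq by blast
  have u: "u \<in> W" using screw_base_plane[OF sub lW] .
  have w: "\<omega> = 0 \<or> w \<in> W"
  proof (cases "\<omega> = 0")
    case False
    have "sn X 1 > 0" using pi_gt3 by (intro sn_pos) (auto simp del: pi_gt3)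
    then show ?thesis using screw_plane[OF sub u lW, of "1 / \<omega>"] False by simp
  qed simp
  let ?T = "{q', r', p'}"
  obtain \<alpha> \<omega>' where ch: "\<omega>'\<^sup>2 = \<omega>\<^sup>2" "\<And>s. l s = chart X e1 e2 (\<alpha> + \<omega>' * s) (t + \<tau> * s)"
    "\<And>s. s \<in> convex hull ?T \<Longrightarrow> \<alpha> + \<omega>' * s \<in> chart_domain X"
    using plane_screw_chart[OF f W_range c(1) u w, of ?T \<tau> t] avoid[of "arc_of l ?T"] unfolding l_eq by blast
  \<comment> \<open>With this constant, h at (\<phi>, t') is \<tau> (\<phi> - \<alpha>) - \<omega>'
    (t' - t), the normal form of the unrolled line l.\<close>
  define h3 where "h3 = \<omega>' * t - \<tau> * \<alpha>"
  define h where "h \<phi> t = \<tau> * \<phi> + (- \<omega>') * t + h3" for \<phi> t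
  have h_on: "h \<phi> t' = 0" if "s \<in> ?T" "\<phi> \<in> chart_domain X" "chart X e1 e2 \<phi> t' = l s" for \<phi> t' s
  proof -
    have "\<alpha> + \<omega>' * s \<in> chart_domain X" using ch(3) hull_inc[OF that(1)] by blast
    then have "\<phi> = \<alpha> + \<omega>' * s" "t' = t + \<tau> * s"
      using chart_inject[OF f that(2)] that(3) ch(2) by metis+
    then show ?thesis by (simp add: h_def h3_def algebra_simps)
  qed
  \<comment> \<open>The chart domain plays no part here: every zero of h maps to l, its parameter
    being the projection to the unit vector (\<omega>', \<tau>). So h is nonzero at any coordinates
    of a vertex.\<close>
  have h_off: "chart X e1 e2 \<phi> t' \<in> range l" if "h \<phi> t' = 0" for \<phi> t'
  proof -
    define s where "s = \<omega>' * (\<phi> - \<alpha>) + \<tau> * (t' - t)"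
    have 1: "\<tau> * (\<phi> - \<alpha>) = \<omega>' * (t' - t)" using that by (simp add: h_def h3_def algebra_simps)
    have 2: "\<omega>' * \<omega>' + \<tau> * \<tau> = 1" using c(3) ch(1) by (simp add: power2_eq_square)
    have "\<phi> = \<alpha> + \<omega>' * s" "t' = t + \<tau> * s"
      using 1 2 unfolding s_def by algebra+
    then have "chart X e1 e2 \<phi> t' = l s" by (simp add: ch(2))
    then show ?thesis by simp
  qed
  have lpts: "P \<in> range l" "Q \<in> range l" "R \<in> range l" using P Q R by auto
  then have lpW: "P \<in> W" "Q \<in> W" "R \<in> W" using l(2) by auto
  have off: "h \<phi> t' \<noteq> 0" if "chart X e1 e2 \<phi> t' \<in> {A0, A1, A2}" for \<phi> t'
    using h_off[of \<phi> t'] that no_vertex by auto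
  note side = side_ratio[OF f W_range sub, where ?h1.0 = \<tau> and ?h2.0 = "- \<omega>'" and ?h3.0 = h3, folded h_def]
  have "\<exists>\<phi>A tA \<phi>B tB. \<phi>A \<in> chart_domain X \<and> chart X e1 e2 \<phi>A tA = A0
    \<and> \<phi>B \<in> chart_domain X \<and> chart X e1 e2 \<phi>B tB = A1
    \<and> simply_ratio X A0 P A1 = - h \<phi>A tA / h \<phi>B tB \<and> simply_ratio X A1 P A0 = - h \<phi>B tB / h \<phi>A tA"
    by (rule side[OF AW(1,2) ne(1) g01 P(2) lpW(1)])
      (use lpts no_vertex off h_on[of p'] P semi avoid in auto)
  then obtain \<phi>0 t0 \<phi>1 t1 where s01: "\<phi>0 \<in> chart_domain X" "chart X e1 e2 \<phi>0 t0 = A0"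
    "\<phi>1 \<in> chart_domain X" "chart X e1 e2 \<phi>1 t1 = A1" "simply_ratio X A0 P A1 = - h \<phi>0 t0 / h \<phi>1 t1"
    by blast
  have "\<exists>\<phi>A tA \<phi>B tB. \<phi>A \<in> chart_domain X \<and> chart X e1 e2 \<phi>A tA = A1
    \<and> \<phi>B \<in> chart_domain X \<and> chart X e1 e2 \<phi>B tB = A2
    \<and> simply_ratio X A1 Q A2 = - h \<phi>A tA / h \<phi>B tB \<and> simply_ratio X A2 Q A1 = - h \<phi>B tB / h \<phi>A tA"
    by (rule side[OF AW(2,3) ne(2) g12 Q(2) lpW(2)])
      (use lpts no_vertex off h_on[of q'] Q semi avoid in auto)
  then obtain \<phi>1' t1' \<phi>2 t2 where s12: "\<phi>1' \<in> chart_domain X" "chart X e1 e2 \<phi>1' t1' = A1"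
    "\<phi>2 \<in> chart_domain X" "chart X e1 e2 \<phi>2 t2 = A2" "simply_ratio X A1 Q A2 = - h \<phi>1' t1' / h \<phi>2 t2"
    by blast
  have "\<exists>\<phi>A tA \<phi>B tB. \<phi>A \<in> chart_domain X \<and> chart X e1 e2 \<phi>A tA = A0
    \<and> \<phi>B \<in> chart_domain X \<and> chart X e1 e2 \<phi>B tB = A2
    \<and> simply_ratio X A0 R A2 = - h \<phi>A tA / h \<phi>B tB \<and> simply_ratio X A2 R A0 = - h \<phi>B tB / h \<phi>A tA"
    by (rule side[OF AW(1,3) ne(3) g02 R(2) lpW(3)])
      (use lpts no_vertex off h_on[of r'] R semi avoid in auto)
  then obtain \<phi>0' t0' \<phi>2' t2' where s02: "\<phi>0' \<in> chart_domain X" "chart X e1 e2 \<phi>0' t0' = A0"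
    "\<phi>2' \<in> chart_domain X" "chart X e1 e2 \<phi>2' t2' = A2" "simply_ratio X A2 R A0 = - h \<phi>2' t2' / h \<phi>0' t0'"
    by blast
  \<comment> \<open>A vertex has the same coordinates on both of its sides, so in the product each
    value of h cancels and three minus signs remain.\<close>
  have "\<phi>1' = \<phi>1" "t1' = t1" "\<phi>0' = \<phi>0" "t0' = t0" "\<phi>2' = \<phi>2" "t2' = t2"
    using chart_inject[OF f] s01 s12 s02 by metis+
  moreover have "h \<phi>0 t0 \<noteq> 0" "h \<phi>1 t1 \<noteq> 0" "h \<phi>2 t2 \<noteq> 0"
    using off s01 s12 by auto
  ultimately show ?thesis by (simp add: s01(5) s12(5) s02(5))
qed

end
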